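(* Let $Q$ be a finite tree quiver, $A=\Bbbk Q$ its path algebra, $N$ and $N'$ the natural left and right $A$-modules, and $X_{ij}=A\varepsilon_i\otimes_\Bbbk\varepsilon_jA$ for $i,j\in Q_0$. (i) For $i,j\in Q_0$, the unique (up to scalar) non-zero $A$-$A$-bimodule homomorphism $\varphi_{ij}:X_{ij}\to N\otimes_\Bbbk N'$ is injective. (ii) The subbimodule $\sum_{i\in Q_0}\mathrm{Im}(\varphi_{ii})$ of $N\otimes_\Bbbk N'$ is isomorphic to ${}_AA_A$.
   Context: $\Bbbk$ is an algebraically closed field. A finite tree quiver $Q=(Q_0,Q_1,s,t)$ is a finite quiver whose underlying graph is a tree. Paths are composed right to left; $\varepsilon_v$ is the trivial path at the vertex $v$. The natural left $A$-module $N$ assigns the $1$-dimensional vector space $\Bbbk$ to each vertex of $Q$ and the identity linear transformation to each arrow of $Q$. The natural right $A$-module $N'$ assigns the $1$-dimensional vector space $\Bbbk$ to each vertex of $Q$ and the identity linear transformation to each arrow of $Q^{\mathrm{op}}$. One has $\dim \varepsilon_i(N\otimes_\Bbbk N')\varepsilon_j=1$ for all $i,j\in Q_0$. *)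

theory Defs
  imports
    "HOL-Computational_Algebra.Polynomial"
    "HOL-Library.Poly_Mapping"
    "Graph_Theory.Graph_Theory"
    "HOL-Algebra.AbelCoset"
    "HOL-Algebra.Module"
begin

section \<open>Tree quivers\<close>

text \<open>
  A finite quiver is a \<^locale>\<open>fin_digraph\<close> (loops and parallel arrows are allowed).  The
  constant \<^const>\<open>Digraph_Component.tree\<close> is not suitable here, since it only excludes
  directed cycles.  A cycle of the underlying multigraph is a cycle of the doubled
  quiver, in which every arrow \<open>e\<close> may be traversed forwards, \<open>(e, True)\<close>, or backwards,
  \<open>(e, False)\<close>, that does not use the same arrow of \<open>Q\<close> twice.
\<close>

definition double_quiver :: "('v, 'e) pre_digraph \<Rightarrow> ('v, 'e \<times> bool) pre_digraph" where
  "double_quiver Q =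
     \<lparr> verts = verts Q, arcs = arcs Q \<times> UNIV,
       tail = (\<lambda>(e, fwd). if fwd then tail Q e else head Q e),
       head = (\<lambda>(e, fwd). if fwd then head Q e else tail Q e) \<rparr>"

definition undirected_cycle :: "('v, 'e) pre_digraph \<Rightarrow> ('e \<times> bool) list \<Rightarrow> bool" where
  "undirected_cycle Q p \<longleftrightarrow>
     pre_digraph.cycle (double_quiver Q) p \<and> distinct (map fst p)"

definition tree_quiver :: "('v, 'e) pre_digraph \<Rightarrow> bool" where
  "tree_quiver Q \<longleftrightarrow>
     fin_digraph Q \<and> Digraph_Component.connected Q \<and> (\<nexists>p. undirected_cycle Q p)"


section \<open>The path algebra\<close>

text \<open>
  A path is stored as (source, arrows in the order of traversal, target).
\<close>

type_synonym ('v, 'e) qpath = "'v \<times> 'e list \<times> 'v"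

definition psource :: "('v, 'e) qpath \<Rightarrow> 'v" where
  "psource p = fst p"

definition parrows :: "('v, 'e) qpath \<Rightarrow> 'e list" where
  "parrows p = fst (snd p)"

definition ptarget :: "('v, 'e) qpath \<Rightarrow> 'v" where
  "ptarget p = snd (snd p)"

definition qpaths :: "('v, 'e) pre_digraph \<Rightarrow> ('v, 'e) qpath set" where
  "qpaths Q = {(u, p, v). pre_digraph.awalk Q u p v}"

text \<open>
  Composition from right to left: \<open>pcomp p q\<close> is first \<open>q\<close>, then \<open>p\<close>.
\<close>

definition pcomp :: "('v, 'e) qpath \<Rightarrow> ('v, 'e) qpath \<Rightarrow> ('v, 'e) qpath" where
  "pcomp p q = (psource q, parrows q @ parrows p, ptarget p)"

type_synonym ('k, 'v, 'e) palg = "('v, 'e) qpath \<Rightarrow>\<^sub>0 'k"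

definition scale :: "'k::field \<Rightarrow> ('b \<Rightarrow>\<^sub>0 'k) \<Rightarrow> ('b \<Rightarrow>\<^sub>0 'k)" where
  "scale c = Poly_Mapping.map ((*) c)"

definition path_algebra :: "('v, 'e) pre_digraph \<Rightarrow> ('k::field, 'v, 'e) palg ring" where
  "path_algebra Q =
     \<lparr> carrier = {a. Poly_Mapping.keys a \<subseteq> qpaths Q},
       mult = (\<lambda>a b. \<Sum>p\<in>Poly_Mapping.keys a. \<Sum>q\<in>Poly_Mapping.keys b.
                 if psource p = ptarget q
                 then Poly_Mapping.single (pcomp p q) (Poly_Mapping.lookup a p * Poly_Mapping.lookup b q)
                 else 0),
       one = (\<Sum>v\<in>verts Q. Poly_Mapping.single (v, [], v) 1),
       zero = 0,
       add = (+) \<rparr>"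

definition trivial_path :: "'v \<Rightarrow> ('k::field, 'v, 'e) palg" where
  "trivial_path v = Poly_Mapping.single (v, [], v) 1"


section \<open>Modules and bimodules\<close>

text \<open>
  All modules carry their \<open>\<k>\<close>-vector space structure in the fields of the record
  \<^typ>\<open>('k, 'm) module\<close>, in which the inherited fields \<open>mult\<close> and \<open>one\<close> play no role.
\<close>

record ('k, 'a, 'm) left_module = "('k, 'm) module" +
  lact :: "'a \<Rightarrow> 'm \<Rightarrow> 'm"

record ('k, 'a, 'm) right_module = "('k, 'm) module" +
  ract :: "'m \<Rightarrow> 'a \<Rightarrow> 'm"

record ('k, 'a, 'm) bimodule = "('k, 'm) module" +
  blact :: "'a \<Rightarrow> 'm \<Rightarrow> 'm"
  bract :: "'m \<Rightarrow> 'a \<Rightarrow> 'm"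

definition bimodule_hom ::
  "('a, 'r) ring_scheme \<Rightarrow> ('k, 'a, 'm) bimodule \<Rightarrow> ('k, 'a, 'n) bimodule \<Rightarrow> ('m \<Rightarrow> 'n) set" where
  "bimodule_hom R M N =
     {f \<in> carrier M \<rightarrow> carrier N.
        (\<forall>x\<in>carrier M. \<forall>y\<in>carrier M. f (x \<oplus>\<^bsub>M\<^esub> y) = f x \<oplus>\<^bsub>N\<^esub> f y) \<and>
        (\<forall>a\<in>carrier R. \<forall>x\<in>carrier M. f (blact M a x) = blact N a (f x)) \<and>
        (\<forall>a\<in>carrier R. \<forall>x\<in>carrier M. f (bract M x a) = bract N (f x) a)}"

definition nonzero_bimodule_hom ::
  "('a, 'r) ring_scheme \<Rightarrow> ('k, 'a, 'm) bimodule \<Rightarrow> ('k, 'a, 'n) bimodule \<Rightarrow> ('m \<Rightarrow> 'n) set" where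
  "nonzero_bimodule_hom R M N =
     {f \<in> bimodule_hom R M N. \<exists>x\<in>carrier M. f x \<noteq> \<zero>\<^bsub>N\<^esub>}"

definition bimodule_isomorphic ::
  "('a, 'r) ring_scheme \<Rightarrow> ('k, 'a, 'm) bimodule \<Rightarrow> ('k, 'a, 'n) bimodule \<Rightarrow> bool" where
  "bimodule_isomorphic R M N \<longleftrightarrow>
     (\<exists>f\<in>bimodule_hom R M N. bij_betw f (carrier M) (carrier N))"

definition subbimodule ::
  "('a, 'r) ring_scheme \<Rightarrow> 'm set \<Rightarrow> ('k, 'a, 'm) bimodule \<Rightarrow> bool" where
  "subbimodule R S M \<longleftrightarrow>
     additive_subgroup S M \<and>
     (\<forall>a\<in>carrier R. \<forall>x\<in>S. blact M a x \<in> S \<and> bract M x a \<in> S)"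

definition sum_of_subsets :: "('m, 'r) ring_scheme \<Rightarrow> 'i set \<Rightarrow> ('i \<Rightarrow> 'm set) \<Rightarrow> 'm set" where
  "sum_of_subsets M I S = {finsum M x I |x. \<forall>i\<in>I. x i \<in> S i}"


subsection \<open>The tensor product over the ground field\<close>

text \<open>
  \<open>V \<otimes> W\<close> is the quotient of the free vector space on \<open>V \<times> W\<close> by the span of the
  bilinearity relators.
\<close>

definition tensor_relators ::
  "('k::field, 'm, 'x) module_scheme \<Rightarrow> ('k, 'n, 'y) module_scheme \<Rightarrow> ('m \<times> 'n \<Rightarrow>\<^sub>0 'k) set" where
  "tensor_relators V W =
     {Poly_Mapping.single (v \<oplus>\<^bsub>V\<^esub> v', w) 1 - Poly_Mapping.single (v, w) 1
        - Poly_Mapping.single (v', w) 1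
      |v v' w. v \<in> carrier V \<and> v' \<in> carrier V \<and> w \<in> carrier W} \<union>
     {Poly_Mapping.single (v, w \<oplus>\<^bsub>W\<^esub> w') 1 - Poly_Mapping.single (v, w) 1
        - Poly_Mapping.single (v, w') 1
      |v w w'. v \<in> carrier V \<and> w \<in> carrier W \<and> w' \<in> carrier W} \<union>
     {Poly_Mapping.single (c \<odot>\<^bsub>V\<^esub> v, w) 1 - Poly_Mapping.single (v, w) c
      |c v w. v \<in> carrier V \<and> w \<in> carrier W} \<union>
     {Poly_Mapping.single (v, c \<odot>\<^bsub>W\<^esub> w) 1 - Poly_Mapping.single (v, w) c
      |c v w. v \<in> carrier V \<and> w \<in> carrier W}"

definition tensor_free ::
  "('k::field, 'm, 'x) module_scheme \<Rightarrow> ('k, 'n, 'y) module_scheme \<Rightarrow> ('m \<times> 'n \<Rightarrow>\<^sub>0 'k) set" where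
  "tensor_free V W = {x. Poly_Mapping.keys x \<subseteq> carrier V \<times> carrier W}"

definition tensor_rel ::
  "('k::field, 'm, 'x) module_scheme \<Rightarrow> ('k, 'n, 'y) module_scheme \<Rightarrow>
     (('m \<times> 'n \<Rightarrow>\<^sub>0 'k) \<times> ('m \<times> 'n \<Rightarrow>\<^sub>0 'k)) set" where
  "tensor_rel V W =
     {(x, y). x \<in> tensor_free V W \<and> y \<in> tensor_free V W \<and>
        x - y \<in> Modules.module.span scale (tensor_relators V W)}"

text \<open>The linear map of free vector spaces induced by a map of bases.\<close>

definition free_map :: "('b \<Rightarrow> 'c) \<Rightarrow> ('b \<Rightarrow>\<^sub>0 'k) \<Rightarrow> ('c \<Rightarrow>\<^sub>0 'k::field)" where
  "free_map f x =
     (\<Sum>b\<in>Poly_Mapping.keys x. Poly_Mapping.single (f b) (Poly_Mapping.lookup x b))"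

text \<open>
  The outer tensor product of a left and a right module, a bimodule via
  \<open>a (m \<otimes> n) b = a m \<otimes> n b\<close>.
\<close>

definition tensor_bimodule ::
  "('k::field, 'a, 'm) left_module \<Rightarrow> ('k, 'a, 'n) right_module \<Rightarrow>
     ('k, 'a, ('m \<times> 'n \<Rightarrow>\<^sub>0 'k) set) bimodule" where
  "tensor_bimodule M N =
     \<lparr> carrier = tensor_free M N // tensor_rel M N,
       mult = undefined,
       one = undefined,
       zero = tensor_rel M N `` {0},
       add = (\<lambda>X Y. \<Union>x\<in>X. \<Union>y\<in>Y. tensor_rel M N `` {x + y}),
       smult = (\<lambda>c X. \<Union>x\<in>X. tensor_rel M N `` {scale c x}),
       blact = (\<lambda>a X. \<Union>x\<in>X. tensor_rel M N `` {free_map (\<lambda>(m, n). (lact M a m, n)) x}),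
       bract = (\<lambda>X a. \<Union>x\<in>X. tensor_rel M N `` {free_map (\<lambda>(m, n). (m, ract N n a)) x}) \<rparr>"


subsection \<open>Modules given by representations\<close>

text \<open>
  The left module of a representation of \<open>Q\<close> with vertex spaces \<open>M v\<close> and linear maps
  \<open>f e : M (tail e) \<rightarrow> M (head e)\<close> is the direct sum of the \<open>M v\<close>, a path acting by the
  composite of the maps at its arrows.  A representation of the opposite quiver,
  \<open>f e : M (head e) \<rightarrow> M (tail e)\<close>, gives a right module.  The first argument after \<open>Q\<close>
  is the scalar multiplication of the vertex spaces.
\<close>

definition rep_space :: "('v, 'e) pre_digraph \<Rightarrow> ('v \<Rightarrow> 'm::ab_group_add set) \<Rightarrow> ('v \<Rightarrow> 'm) set" where
  "rep_space Q M = {x. (\<forall>v\<in>verts Q. x v \<in> M v) \<and> (\<forall>v. v \<notin> verts Q \<longrightarrow> x v = 0)}"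

definition left_module_of_rep ::
  "('v, 'e) pre_digraph \<Rightarrow> ('k::field \<Rightarrow> 'm::ab_group_add \<Rightarrow> 'm) \<Rightarrow> ('v \<Rightarrow> 'm set) \<Rightarrow>
     ('e \<Rightarrow> 'm \<Rightarrow> 'm) \<Rightarrow> ('k, ('k, 'v, 'e) palg, 'v \<Rightarrow> 'm) left_module" where
  "left_module_of_rep Q sc M f =
     \<lparr> carrier = rep_space Q M,
       mult = undefined,
       one = undefined,
       zero = (\<lambda>v. 0),
       add = (\<lambda>x y v. x v + y v),
       smult = (\<lambda>c x v. sc c (x v)),
       lact = (\<lambda>a x v. \<Sum>p | p \<in> Poly_Mapping.keys a \<and> ptarget p = v.
                 sc (Poly_Mapping.lookup a p) (fold f (parrows p) (x (psource p)))) \<rparr>"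

definition right_module_of_rep ::
  "('v, 'e) pre_digraph \<Rightarrow> ('k::field \<Rightarrow> 'm::ab_group_add \<Rightarrow> 'm) \<Rightarrow> ('v \<Rightarrow> 'm set) \<Rightarrow>
     ('e \<Rightarrow> 'm \<Rightarrow> 'm) \<Rightarrow> ('k, ('k, 'v, 'e) palg, 'v \<Rightarrow> 'm) right_module" where
  "right_module_of_rep Q sc M f =
     \<lparr> carrier = rep_space Q M,
       mult = undefined,
       one = undefined,
       zero = (\<lambda>v. 0),
       add = (\<lambda>x y v. x v + y v),
       smult = (\<lambda>c x v. sc c (x v)),
       ract = (\<lambda>x a v. \<Sum>p | p \<in> Poly_Mapping.keys a \<and> psource p = v.
                 sc (Poly_Mapping.lookup a p) (foldr f (parrows p) (x (ptarget p)))) \<rparr>"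

definition natural_left_module ::
  "('v, 'e) pre_digraph \<Rightarrow> ('k::field, ('k, 'v, 'e) palg, 'v \<Rightarrow> 'k) left_module" where
  "natural_left_module Q = left_module_of_rep Q (*) (\<lambda>v. UNIV) (\<lambda>e. id)"

definition natural_right_module ::
  "('v, 'e) pre_digraph \<Rightarrow> ('k::field, ('k, 'v, 'e) palg, 'v \<Rightarrow> 'k) right_module" where
  "natural_right_module Q = right_module_of_rep Q (*) (\<lambda>v. UNIV) (\<lambda>e. id)"

definition natural_bimodule ::
  "('v, 'e) pre_digraph \<Rightarrow>
     ('k::field, ('k, 'v, 'e) palg, (('v \<Rightarrow> 'k) \<times> ('v \<Rightarrow> 'k) \<Rightarrow>\<^sub>0 'k) set) bimodule" where
  "natural_bimodule Q = tensor_bimodule (natural_left_module Q) (natural_right_module Q)"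


subsection \<open>The regular bimodule and the bimodules \<open>A \<epsilon>\<^sub>i \<otimes> \<epsilon>\<^sub>j A\<close>\<close>

definition regular_bimodule ::
  "('v, 'e) pre_digraph \<Rightarrow> ('k::field, ('k, 'v, 'e) palg, ('k, 'v, 'e) palg) bimodule" where
  "regular_bimodule Q =
     \<lparr> carrier = carrier (path_algebra Q),
       mult = undefined,
       one = undefined,
       zero = \<zero>\<^bsub>path_algebra Q\<^esub>,
       add = (\<oplus>\<^bsub>path_algebra Q\<^esub>),
       smult = scale,
       blact = (\<otimes>\<^bsub>path_algebra Q\<^esub>),
       bract = (\<otimes>\<^bsub>path_algebra Q\<^esub>) \<rparr>"

definition left_projective ::
  "('v, 'e) pre_digraph \<Rightarrow> 'v \<Rightarrow> ('k::field, ('k, 'v, 'e) palg, ('k, 'v, 'e) palg) left_module" where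
  "left_projective Q i =
     \<lparr> carrier = {a \<otimes>\<^bsub>path_algebra Q\<^esub> trivial_path i |a. a \<in> carrier (path_algebra Q)},
       mult = undefined,
       one = undefined,
       zero = \<zero>\<^bsub>path_algebra Q\<^esub>,
       add = (\<oplus>\<^bsub>path_algebra Q\<^esub>),
       smult = scale,
       lact = (\<otimes>\<^bsub>path_algebra Q\<^esub>) \<rparr>"

definition right_projective ::
  "('v, 'e) pre_digraph \<Rightarrow> 'v \<Rightarrow> ('k::field, ('k, 'v, 'e) palg, ('k, 'v, 'e) palg) right_module" where
  "right_projective Q j =
     \<lparr> carrier = {trivial_path j \<otimes>\<^bsub>path_algebra Q\<^esub> a |a. a \<in> carrier (path_algebra Q)},
       mult = undefined,
       one = undefined,
       zero = \<zero>\<^bsub>path_algebra Q\<^esub>,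
       add = (\<oplus>\<^bsub>path_algebra Q\<^esub>),
       smult = scale,
       ract = (\<otimes>\<^bsub>path_algebra Q\<^esub>) \<rparr>"

definition projective_bimodule ::
  "('v, 'e) pre_digraph \<Rightarrow> 'v \<Rightarrow> 'v \<Rightarrow>
     ('k::field, ('k, 'v, 'e) palg,
      (('k, 'v, 'e) palg \<times> ('k, 'v, 'e) palg \<Rightarrow>\<^sub>0 'k) set) bimodule" where
  "projective_bimodule Q i j = tensor_bimodule (left_projective Q i) (right_projective Q j)"

end

theory Submission
  imports Defs
begin

text \<open>
  In a tree there is at most one directed path from a vertex \<open>w\<close> to a vertex \<open>u\<close>
  (\<open>tree_quiver_unique_path_quiver\<close>).  Sending this path to the matrix unit \<open>E u w\<close> is
  therefore a faithful representation \<open>path_matrix\<close> of the path algebra \<open>A\<close> by matrices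
  indexed by the vertices, and its image consists of all matrices supported on the relation
  \<open>reach\<close>, the set of pairs \<open>(u, w)\<close> with a path from \<open>w\<close> to \<open>u\<close> (\<open>path_matrix_bij\<close>).

  All bimodules of the theorem are spaces of matrices with a prescribed support on which
  \<open>A\<close> acts by matrix multiplication through this representation; this is the notion of a
  \<open>matrix_model\<close>.  The natural modules are the columns and the rows, so \<open>N \<otimes> N'\<close> is the
  space of all matrices.  Since \<open>A \<epsilon>\<^sub>i\<close> is column \<open>i\<close> of \<open>A\<close> and \<open>\<epsilon>\<^sub>j A\<close> is row \<open>j\<close>, the
  bimodule \<open>X i j\<close> is the space of matrices supported on the rectangle of all \<open>(u, w)\<close> such
  that \<open>u\<close> can be reached from \<open>i\<close> and \<open>j\<close> can be reached from \<open>w\<close>.  The regular bimodule is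
  the space of matrices supported on \<open>reach\<close>.

  For part (i), let \<open>\<phi>\<close> be a homomorphism from \<open>X i j\<close> to \<open>N \<otimes> N'\<close>.  The matrix \<open>E i j\<close>
  is fixed by \<open>\<epsilon>\<^sub>i\<close> on the left and by \<open>\<epsilon>\<^sub>j\<close> on the right, so its image is \<open>c\<close> times
  \<open>E i j\<close> for some \<open>c\<close>; and \<open>E i j\<close> generates \<open>X i j\<close>, because \<open>E u w\<close> is \<open>p (E i j) q\<close> for
  a path \<open>p\<close> from \<open>i\<close> to \<open>u\<close> and a path \<open>q\<close> from \<open>w\<close> to \<open>j\<close>.  So \<open>\<phi>\<close> multiplies every
  matrix by \<open>c\<close> (\<open>hom_is_scalar\<close>), which is injective when \<open>c\<close> is not zero, and the
  inclusion of matrix spaces is the homomorphism with \<open>c = 1\<close>.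

  For part (ii), the image of \<open>X i i\<close> is by the same argument the full space of matrices
  supported on the rectangle at \<open>i\<close>.  The union of these rectangles over all \<open>i\<close> is \<open>reach\<close>,
  so the sum of the images is the space of matrices supported on \<open>reach\<close>
  (\<open>sum_of_images\<close>), which is the image of \<open>A\<close>.
\<close>

section \<open>Uniqueness of directed paths in a tree\<close>

lemma wf_digraph_double_quiver:
  assumes "wf_digraph Q"
  shows "wf_digraph (double_quiver Q)"
proof -
  interpret wf_digraph Q by fact
  show ?thesis by unfold_locales (auto simp: double_quiver_def split: if_splits)
qed

lemma awalk_double_quiver_forward:
  assumes "wf_digraph Q" and "pre_digraph.awalk Q u p v"
  shows "pre_digraph.awalk (double_quiver Q) u (map (\<lambda>e. (e, True)) p) v"
  using assms(2)
proof (induction p arbitrary: u)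
  case Nil
  then show ?case by (auto simp: pre_digraph.awalk_def pre_digraph.cas.simps double_quiver_def)
next
  case (Cons e p)
  interpret wf_digraph Q by fact
  interpret D: wf_digraph "double_quiver Q" using wf_digraph_double_quiver assms(1) .
  from Cons show ?case by (simp add: awalk_Cons_iff D.awalk_Cons_iff) (simp add: double_quiver_def)
qed

lemma awalk_double_quiver_backward:
  assumes "wf_digraph Q" and "pre_digraph.awalk Q u p v"
  shows "pre_digraph.awalk (double_quiver Q) v (rev (map (\<lambda>e. (e, False)) p)) u"
  using assms(2)
proof (induction p arbitrary: u)
  case Nil
  then show ?case by (auto simp: pre_digraph.awalk_def pre_digraph.cas.simps double_quiver_def)
next
  case (Cons e p)
  interpret wf_digraph Q by fact
  interpret D: wf_digraph "double_quiver Q" using wf_digraph_double_quiver assms(1) .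
  from Cons have e: "e \<in> arcs Q" "u = tail Q e" "awalk (head Q e) p v"
    by (auto simp: awalk_Cons_iff)
  have "D.awalk (head Q e) [(e, False)] u"
    using e by (simp add: D.awalk_Cons_iff D.awalk_Nil_iff) (simp add: double_quiver_def)
  from D.awalk_appendI[OF Cons.IH[OF e(3)] this] show ?case by simp
qed

text \<open>
  Cutting a closed walk at a repeated vertex leaves a shorter closed walk whose arrows are
  still pairwise distinct, so a shortest one repeats no vertex and is a cycle.
\<close>

lemma closed_walk_imp_undirected_cycle:
  assumes "wf_digraph Q" and "pre_digraph.awalk (double_quiver Q) u p u"
    and "p \<noteq> []" and "distinct (map fst p)"
  shows "\<exists>c. undirected_cycle Q c"
  using assms(2-)
proof (induction "length p" arbitrary: u p rule: less_induct)
  case less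
  interpret D: wf_digraph "double_quiver Q" using wf_digraph_double_quiver assms(1) .
  show ?case
  proof (cases "distinct (tl (D.awalk_verts u p))")
    case True
    with less.prems have "undirected_cycle Q p" by (auto simp: undirected_cycle_def D.cycle_def)
    then show ?thesis ..
  next
    case False
    with less.prems obtain e es where p: "p = e # es"
      and es: "D.awalk (head (double_quiver Q) e) es u"
        "\<not> distinct (D.awalk_verts (head (double_quiver Q) e) es)"
      by (cases p) (auto simp: D.awalk_Cons_iff)
    obtain q r s where qrs: "es = q @ r @ s" and r: "\<exists>w. D.awalk w r w" "D.closed_w r"
      using D.awalk_cyc_decompE'[OF es] by metis
    have "length r < length p" "r \<noteq> []" "distinct (map fst r)"
      using less.prems r qrs p by (auto simp: D.closed_w_def)
    with less.hyps r show ?thesis by blast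
  qed
qed

text \<open>
  If \<open>p\<close> and \<open>q\<close> share an arrow, they differ before it or after it, which gives a
  shorter pair; if one of them repeats an arrow, it contains a nonempty closed walk, which is
  parallel to the trivial one and again makes a shorter pair.  In the remaining case going
  along \<open>p\<close> and back along \<open>q\<close> is a closed walk that uses every arrow at most once.
\<close>

lemma distinct_parallel_walks_imp_undirected_cycle:
  assumes "wf_digraph Q"
    and "pre_digraph.awalk Q u p v" and "pre_digraph.awalk Q u q v" and "p \<noteq> q"
  shows "\<exists>c. undirected_cycle Q c"
  using assms(2-)
proof (induction "length p + length q" arbitrary: u v p q rule: less_induct)
  case less
  interpret wf_digraph Q by fact
  interpret D: wf_digraph "double_quiver Q" using wf_digraph_double_quiver assms(1) .
  have repeated: "\<exists>c. undirected_cycle Q c"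
    if w: "awalk u w v" "\<not> distinct w" "length w \<le> length p + length q" for w
  proof -
    from w(2) obtain r s t a where wd: "w = r @ [a] @ s @ [a] @ t"
      using not_distinct_decomp by blast
    have "awalk (tail Q a) (a # s) (tail Q a)"
      using w(1) unfolding wd by (auto simp: awalk_Cons_iff)
    moreover from this have "awalk (tail Q a) [] (tail Q a)"
      by (auto simp: awalk_Nil_iff)
    moreover have "length (a # s) + length ([] :: 'b list) < length p + length q"
      using w(3) wd by simp
    ultimately show ?thesis using less.hyps[of "a # s" "[]"] by simp
  qed
  show ?case
  proof (cases "set p \<inter> set q = {}")
    case False
    then obtain a p1 p2 q1 q2 where d: "p = p1 @ a # p2" "q = q1 @ a # q2"
      by (meson disjoint_iff split_list)
    with less.prems have
      1: "awalk u p1 (tail Q a)" "awalk u q1 (tail Q a)" and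
      2: "awalk (head Q a) p2 v" "awalk (head Q a) q2 v"
      by (auto simp: awalk_Cons_iff)
    from less.prems(3) d consider "p1 \<noteq> q1" | "p2 \<noteq> q2" by blast
    then show ?thesis
    proof cases
      assume "p1 \<noteq> q1"
      with less.hyps[OF _ 1] d show ?thesis by simp
    next
      assume "p2 \<noteq> q2"
      with less.hyps[OF _ 2] d show ?thesis by simp
    qed
  next
    case disj: True
    show ?thesis
    proof (cases "distinct p \<and> distinct q")
      case False
      with repeated less.prems show ?thesis by auto
    next
      case True
      let ?c = "map (\<lambda>e. (e, True)) p @ rev (map (\<lambda>e. (e, False)) q)"
      have "D.awalk u ?c u"
        using awalk_double_quiver_forward[OF assms(1) less.prems(1)]
          awalk_double_quiver_backward[OF assms(1) less.prems(2)]
        by (rule D.awalk_appendI)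
      moreover have "?c \<noteq> []" using less.prems(3) by auto
      moreover have "distinct (map fst ?c)"
        using True disj by (auto simp: rev_map comp_def)
      ultimately show ?thesis by (rule closed_walk_imp_undirected_cycle[OF assms(1)])
    qed
  qed
qed

section \<open>Linear extension from a basis\<close>

lemma lookup_scale [simp]: "Poly_Mapping.lookup (scale c x) b = c * Poly_Mapping.lookup x b"
  by (simp add: scale_def Poly_Mapping.map.rep_eq when_def)

lemma keys_scale: "Poly_Mapping.keys (scale c x) \<subseteq> Poly_Mapping.keys x"
  by (auto simp: in_keys_iff)

lemma scale_single: "scale c (Poly_Mapping.single b d) = Poly_Mapping.single b (c * d)"
  by (rule poly_mapping_eqI) (simp add: lookup_single when_def)

lemma vector_space_scale: "vector_space (scale :: 'k::field \<Rightarrow> ('b \<Rightarrow>\<^sub>0 'k) \<Rightarrow> _)"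
  by unfold_locales (rule poly_mapping_eqI; simp add: lookup_add algebra_simps)+

definition lin_ext :: "('b \<Rightarrow> 'k) \<Rightarrow> ('b \<Rightarrow>\<^sub>0 'k) \<Rightarrow> 'k::field" where
  "lin_ext h x = (\<Sum>b\<in>Poly_Mapping.keys x. Poly_Mapping.lookup x b * h b)"

lemma lin_ext_superset:
  assumes "finite S" "Poly_Mapping.keys x \<subseteq> S"
  shows "lin_ext h x = (\<Sum>b\<in>S. Poly_Mapping.lookup x b * h b)"
  unfolding lin_ext_def by (rule sum.mono_neutral_left) (use assms in \<open>auto simp: in_keys_iff\<close>)

lemma lin_ext_zero [simp]: "lin_ext h 0 = 0"
  by (simp add: lin_ext_def)

lemma lin_ext_add: "lin_ext h (x + y) = lin_ext h x + lin_ext h y"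
proof -
  let ?S = "Poly_Mapping.keys x \<union> Poly_Mapping.keys y"
  have "Poly_Mapping.keys (x + y) \<subseteq> ?S" by (rule keys_add)
  then show ?thesis
    by (simp add: lin_ext_superset[of ?S] lookup_add distrib_right sum.distrib)
qed

lemma lin_ext_scale: "lin_ext h (scale c x) = c * lin_ext h x"
  unfolding lin_ext_superset[OF finite_keys keys_scale]
  by (simp add: lin_ext_def sum_distrib_left mult.assoc)

lemma lin_ext_diff: "lin_ext h (x - y) = lin_ext h x - lin_ext h y"
  using lin_ext_add[of h "x - y" y] by simp

lemma lin_ext_sum: "lin_ext h (\<Sum>i\<in>S. x i) = (\<Sum>i\<in>S. lin_ext h (x i))"
  by (induction S rule: infinite_finite_induct) (auto simp: lin_ext_add)

lemma lin_ext_single [simp]: "lin_ext h (Poly_Mapping.single b c) = c * h b"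
  by (simp add: lin_ext_superset[of "{b}"])

lemma lin_ext_free_map: "lin_ext h (free_map f x) = lin_ext (\<lambda>b. h (f b)) x"
  by (simp add: free_map_def lin_ext_sum) (simp add: lin_ext_def)

lemma keys_free_map: "Poly_Mapping.keys (free_map f x) \<subseteq> f ` Poly_Mapping.keys x"
  unfolding free_map_def by (force dest!: subsetD[OF keys_sum] split: if_splits)

lemma lin_ext_cong: "(\<And>b. b \<in> Poly_Mapping.keys x \<Longrightarrow> f b = g b) \<Longrightarrow> lin_ext f x = lin_ext g x"
  by (simp add: lin_ext_def)

lemma lin_ext_sum_fun: "lin_ext (\<lambda>b. \<Sum>z\<in>S. c z * h z b) x = (\<Sum>z\<in>S. c z * lin_ext (h z) x)"
  unfolding lin_ext_def sum_distrib_left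
  by (subst sum.swap) (simp add: mult_ac)

section \<open>The matrix representation of the path algebra\<close>

definition matrices_on :: "('v \<times> 'v) set \<Rightarrow> ('v \<Rightarrow> 'v \<Rightarrow> 'k::zero) set" where
  "matrices_on P = {F. \<forall>u w. (u, w) \<notin> P \<longrightarrow> F u w = 0}"

definition mat_mult ::
  "('v, 'e) pre_digraph \<Rightarrow> ('v \<Rightarrow> 'v \<Rightarrow> 'k::field) \<Rightarrow> ('v \<Rightarrow> 'v \<Rightarrow> 'k) \<Rightarrow> 'v \<Rightarrow> 'v \<Rightarrow> 'k" where
  "mat_mult Q F G = (\<lambda>u w. \<Sum>z\<in>verts Q. F u z * G z w)"

definition elem_matrix :: "'v \<Rightarrow> 'v \<Rightarrow> 'k \<Rightarrow> 'v \<Rightarrow> 'v \<Rightarrow> 'k::field" where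
  "elem_matrix i j c = (\<lambda>u w. if u = i \<and> w = j then c else 0)"

text \<open>
  The representation that sends a path from \<open>w\<close> to \<open>u\<close> to the matrix unit at \<open>(u, w)\<close>.
  Paths compose from right to left, so rows belong to targets and columns to sources.
\<close>

definition path_matrix :: "('k::field, 'v, 'e) palg \<Rightarrow> 'v \<Rightarrow> 'v \<Rightarrow> 'k" where
  "path_matrix a = (\<lambda>u w. lin_ext (\<lambda>p. elem_matrix (ptarget p) (psource p) 1 u w) a)"

definition reach :: "('v, 'e) pre_digraph \<Rightarrow> ('v \<times> 'v) set" where
  "reach Q = (\<lambda>p. (ptarget p, psource p)) ` qpaths Q"

lemma matrices_on_mono: "P \<subseteq> P' \<Longrightarrow> matrices_on P \<subseteq> matrices_on P'"
  by (auto simp: matrices_on_def)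

lemma path_matrix_zero: "path_matrix 0 u w = 0"
  by (simp add: path_matrix_def)

lemma path_matrix_add: "path_matrix (a + b) u w = path_matrix a u w + path_matrix b u w"
  by (simp add: path_matrix_def lin_ext_add)

lemma path_matrix_scale: "path_matrix (scale c a) u w = c * path_matrix a u w"
  by (simp add: path_matrix_def lin_ext_scale)

lemma path_matrix_single:
  "path_matrix (Poly_Mapping.single p c) = elem_matrix (ptarget p) (psource p) c"
  by (auto simp: path_matrix_def elem_matrix_def fun_eq_iff)

lemma path_matrix_trivial_path: "path_matrix (trivial_path v) = elem_matrix v v 1"
  by (simp add: trivial_path_def path_matrix_single ptarget_def psource_def)

context fin_digraph
begin

lemma elem_matrix_mult:
  assumes "i \<in> verts G" "j \<in> verts G"
  shows "mat_mult G (elem_matrix i j c) F u w = (if u = i then c * F j w else 0)"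
    and "mat_mult G F (elem_matrix i j c) u w = (if w = j then F u i * c else 0)"
proof -
  have "mat_mult G (elem_matrix i j c) F u w = (\<Sum>z\<in>verts G. if z = j then (if u = i then c * F j w else 0) else 0)"
    unfolding mat_mult_def elem_matrix_def by (rule sum.cong) auto
  then show "mat_mult G (elem_matrix i j c) F u w = (if u = i then c * F j w else 0)"
    using assms by (simp add: sum.delta)
  have "mat_mult G F (elem_matrix i j c) u w = (\<Sum>z\<in>verts G. if z = i then (if w = j then F u i * c else 0) else 0)"
    unfolding mat_mult_def elem_matrix_def by (rule sum.cong) auto
  then show "mat_mult G F (elem_matrix i j c) u w = (if w = j then F u i * c else 0)"
    using assms by (simp add: sum.delta)
qed

lemma qpath_ends_in_verts:
  assumes "p \<in> qpaths G"
  shows "psource p \<in> verts G" "ptarget p \<in> verts G"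
  using assms by (auto simp: qpaths_def psource_def ptarget_def)

lemma reach_subset_verts: "reach G \<subseteq> verts G \<times> verts G"
  using qpath_ends_in_verts by (auto simp: reach_def)

lemma trivial_qpath: "v \<in> verts G \<Longrightarrow> (v, [], v) \<in> qpaths G"
  by (auto simp: qpaths_def awalk_Nil_iff)

lemma reach_refl: "v \<in> verts G \<Longrightarrow> (v, v) \<in> reach G"
  using trivial_qpath by (force simp: reach_def ptarget_def psource_def)

lemma pcomp_in_qpaths:
  assumes "p \<in> qpaths G" "q \<in> qpaths G" "psource p = ptarget q"
  shows "pcomp p q \<in> qpaths G"
  using assms awalk_appendI
  by (auto simp: qpaths_def pcomp_def psource_def ptarget_def parrows_def simp del: awalk_append_iff)

lemma psource_pcomp [simp]: "psource (pcomp p q) = psource q"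
  and ptarget_pcomp [simp]: "ptarget (pcomp p q) = ptarget p"
  by (simp_all add: pcomp_def psource_def ptarget_def)

lemma reach_trans:
  assumes "(u, v) \<in> reach G" "(v, w) \<in> reach G"
  shows "(u, w) \<in> reach G"
proof -
  from assms obtain p q where pq: "p \<in> qpaths G" "q \<in> qpaths G" "ptarget p = u" "psource p = v"
    "ptarget q = v" "psource q = w"
    by (auto simp: reach_def)
  then have "pcomp p q \<in> qpaths G" by (intro pcomp_in_qpaths) auto
  with pq show ?thesis unfolding reach_def by (intro image_eqI[of _ _ "pcomp p q"]) simp_all
qed

lemma path_matrix_on_reach:
  assumes "a \<in> carrier (path_algebra G)"
  shows "path_matrix a \<in> matrices_on (reach G)"
  using assms
  by (fastforce simp: path_algebra_def matrices_on_def path_matrix_def lin_ext_def reach_def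
      elem_matrix_def intro!: sum.neutral)

lemma path_algebra_add_closed:
  "a \<in> carrier (path_algebra G) \<Longrightarrow> b \<in> carrier (path_algebra G) \<Longrightarrow> a + b \<in> carrier (path_algebra G)"
  using keys_add by (fastforce simp: path_algebra_def)

lemma path_algebra_scale_closed:
  "a \<in> carrier (path_algebra G) \<Longrightarrow> scale c a \<in> carrier (path_algebra G)"
  using keys_scale by (fastforce simp: path_algebra_def)

lemma path_algebra_single_closed:
  "p \<in> qpaths G \<Longrightarrow> Poly_Mapping.single p c \<in> carrier (path_algebra G)"
  by (simp add: path_algebra_def)

lemma trivial_path_closed: "v \<in> verts G \<Longrightarrow> trivial_path v \<in> carrier (path_algebra G)"
  by (simp add: trivial_path_def path_algebra_single_closed trivial_qpath)

lemma path_algebra_mult_closed: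
  assumes "a \<in> carrier (path_algebra G)" "b \<in> carrier (path_algebra G)"
  shows "a \<otimes>\<^bsub>path_algebra G\<^esub> b \<in> carrier (path_algebra G)"
proof -
  have "Poly_Mapping.keys (if psource p = ptarget q
      then Poly_Mapping.single (pcomp p q) (Poly_Mapping.lookup a p * Poly_Mapping.lookup b q) else 0)
    \<subseteq> qpaths G" if "p \<in> Poly_Mapping.keys a" "q \<in> Poly_Mapping.keys b" for p q
    using that assms pcomp_in_qpaths[of p q] by (auto simp: path_algebra_def)
  then show ?thesis
    unfolding path_algebra_def by (force dest!: subsetD[OF keys_sum])
qed

text \<open>
  For paths this is the rule for products of matrix units: a product vanishes unless the
  inner indices, the source of the left path and the target of the right one, agree.
\<close>

lemma path_matrix_mult:
  fixes a b :: "('k::field, 'a, 'b) palg"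
  assumes "a \<in> carrier (path_algebra G)" "b \<in> carrier (path_algebra G)"
  shows "path_matrix (a \<otimes>\<^bsub>path_algebra G\<^esub> b) = mat_mult G (path_matrix a) (path_matrix b)"
proof (intro ext)
  fix u w
  let ?E = "\<lambda>p :: ('a, 'b) qpath. elem_matrix (ptarget p) (psource p) (1 :: 'k)"
  let ?a = "Poly_Mapping.lookup a" and ?b = "Poly_Mapping.lookup b"
  have comp: "(if psource p = ptarget q then ?E (pcomp p q) u w else 0) = mat_mult G (?E p) (?E q) u w"
    if "p \<in> Poly_Mapping.keys a" "q \<in> Poly_Mapping.keys b" for p q
  proof -
    have "p \<in> qpaths G" using that assms by (auto simp: path_algebra_def)
    from elem_matrix_mult(1)[OF qpath_ends_in_verts(2)[OF this] qpath_ends_in_verts(1)[OF this], of 1 "?E q" u w]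
    show ?thesis by (auto simp: elem_matrix_def)
  qed
  have "path_matrix (a \<otimes>\<^bsub>path_algebra G\<^esub> b) u w =
      (\<Sum>p\<in>Poly_Mapping.keys a. \<Sum>q\<in>Poly_Mapping.keys b.
        ?a p * ?b q * (if psource p = ptarget q then ?E (pcomp p q) u w else 0))"
    unfolding path_matrix_def path_algebra_def
    by (auto simp: lin_ext_sum intro!: sum.cong)
  also have "\<dots> = (\<Sum>p\<in>Poly_Mapping.keys a. \<Sum>q\<in>Poly_Mapping.keys b. \<Sum>z\<in>verts G.
        (?a p * ?E p u z) * (?b q * ?E q z w))"
    by (intro sum.cong refl, subst comp)
       (auto simp: mat_mult_def sum_distrib_left mult_ac)
  also have "\<dots> = (\<Sum>p\<in>Poly_Mapping.keys a. \<Sum>z\<in>verts G. \<Sum>q\<in>Poly_Mapping.keys b.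
        (?a p * ?E p u z) * (?b q * ?E q z w))"
    by (intro sum.cong refl sum.swap)
  also have "\<dots> = (\<Sum>z\<in>verts G. \<Sum>p\<in>Poly_Mapping.keys a. \<Sum>q\<in>Poly_Mapping.keys b.
        (?a p * ?E p u z) * (?b q * ?E q z w))"
    by (rule sum.swap)
  also have "\<dots> = mat_mult G (path_matrix a) (path_matrix b) u w"
    by (simp add: mat_mult_def path_matrix_def lin_ext_def sum_product)
  finally show "path_matrix (a \<otimes>\<^bsub>path_algebra G\<^esub> b) u w = mat_mult G (path_matrix a) (path_matrix b) u w" .
qed

end

text \<open>
  The consequence of the tree property on which everything else rests: a path is determined
  by its end points, hence by the position of its matrix unit.
\<close>

locale unique_path_quiver = fin_digraph Q for Q :: "('v, 'e) pre_digraph" +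
  assumes unique_path:
    "\<lbrakk>p \<in> qpaths Q; q \<in> qpaths Q; psource p = psource q; ptarget p = ptarget q\<rbrakk> \<Longrightarrow> p = q"
begin

lemma path_matrix_entry:
  assumes "a \<in> carrier (path_algebra Q)" "p \<in> qpaths Q"
  shows "path_matrix a (ptarget p) (psource p) = Poly_Mapping.lookup a p"
proof -
  have "path_matrix a (ptarget p) (psource p) =
    (\<Sum>q\<in>Poly_Mapping.keys a. if q = p then Poly_Mapping.lookup a q else 0)"
    unfolding path_matrix_def lin_ext_def
  proof (rule sum.cong)
    fix q assume "q \<in> Poly_Mapping.keys a"
    then have "q \<in> qpaths Q" using assms(1) by (auto simp: path_algebra_def)
    then have "psource p = psource q \<and> ptarget p = ptarget q \<longleftrightarrow> q = p"
      using unique_path[of q p] assms(2) by auto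
    then show "Poly_Mapping.lookup a q * elem_matrix (ptarget q) (psource q) 1 (ptarget p) (psource p)
      = (if q = p then Poly_Mapping.lookup a q else 0)"
      by (auto simp: elem_matrix_def)
  qed simp
  also have "\<dots> = Poly_Mapping.lookup a p" by (simp add: sum.delta in_keys_iff)
  finally show ?thesis .
qed

lemma finite_qpaths: "finite (qpaths Q)"
proof (rule inj_on_finite)
  show "inj_on (\<lambda>p. (ptarget p, psource p)) (qpaths Q)"
    by (rule inj_onI) (use unique_path in blast)
  show "(\<lambda>p. (ptarget p, psource p)) ` qpaths Q \<subseteq> verts Q \<times> verts Q"
    using reach_subset_verts by (simp add: reach_def)
qed simp

text \<open>
  Distinct paths go to distinct matrix units, so the representation is faithful, and its
  image is spanned by the matrix units at which some path sits.
\<close>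

lemma path_matrix_bij:
  "bij_betw (path_matrix :: ('k::field, 'v, 'e) palg \<Rightarrow> _) (carrier (path_algebra Q)) (matrices_on (reach Q))"
  (is "bij_betw _ ?A _")
proof (rule bij_betw_imageI)
  show "inj_on path_matrix ?A"
  proof (rule inj_onI, rule poly_mapping_eqI)
    fix a b :: "('k, 'v, 'e) palg" and p
    assume ab: "a \<in> ?A" "b \<in> ?A" "path_matrix a = path_matrix b"
    show "Poly_Mapping.lookup a p = Poly_Mapping.lookup b p"
    proof (cases "p \<in> qpaths Q")
      case True
      then show ?thesis using ab path_matrix_entry by metis
    next
      case False
      then have "p \<notin> Poly_Mapping.keys a" "p \<notin> Poly_Mapping.keys b"
        using ab by (auto simp: path_algebra_def)
      then show ?thesis by (simp add: in_keys_iff)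
    qed
  qed
  show "path_matrix ` ?A = matrices_on (reach Q)"
  proof (intro equalityI subsetI)
    fix F :: "'v \<Rightarrow> 'v \<Rightarrow> 'k"
    assume F: "F \<in> matrices_on (reach Q)"
    define a where "a = (\<Sum>p\<in>qpaths Q. Poly_Mapping.single p (F (ptarget p) (psource p)))"
    have lookup_a: "Poly_Mapping.lookup a p = F (ptarget p) (psource p)" if "p \<in> qpaths Q" for p
      using that finite_qpaths
      by (simp add: a_def lookup_sum lookup_single when_def sum.delta)
    have a: "a \<in> ?A"
      unfolding a_def path_algebra_def by (force dest!: subsetD[OF keys_sum] split: if_splits)
    have "path_matrix a u w = F u w" for u w
    proof (cases "(u, w) \<in> reach Q")
      case True
      then show ?thesis using path_matrix_entry[OF a] lookup_a by (auto simp: reach_def)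
    next
      case False
      then show ?thesis using F path_matrix_on_reach[OF a] by (auto simp: matrices_on_def)
    qed
    then have "path_matrix a = F" by blast
    with a show "F \<in> path_matrix ` ?A" by blast
  qed (use path_matrix_on_reach in blast)
qed

end

lemma tree_quiver_unique_path_quiver:
  assumes "tree_quiver Q"
  shows "unique_path_quiver Q"
proof -
  interpret fin_digraph Q using assms by (simp add: tree_quiver_def)
  show ?thesis
  proof
    fix p q assume pq: "p \<in> qpaths Q" "q \<in> qpaths Q" "psource p = psource q" "ptarget p = ptarget q"
    obtain u es v where p: "p = (u, es, v)" by (cases p)
    obtain es' where q: "q = (u, es', v)"
      using pq(3,4) p by (cases q) (auto simp: psource_def ptarget_def)
    have "awalk u es v" "awalk u es' v" using pq p q by (auto simp: qpaths_def)
    then have "es = es'"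
      using distinct_parallel_walks_imp_undirected_cycle[OF wf_digraph_axioms] assms
      by (auto simp: tree_quiver_def)
    with p q show "p = q" by simp
  qed
qed

section \<open>Coordinates on tensor products\<close>

text \<open>
  A finite-dimensional space, given as a module record, together with a linear bijection
  onto the functions on a finite index set, extended by zero outside of that set.
\<close>

locale coordinates =
  fixes V :: "('k::field, 'm, 'x) module_scheme" and \<gamma> :: "'m \<Rightarrow> 'i \<Rightarrow> 'k" and I :: "'i set"
  assumes finite_index: "finite I"
    and coord_bij: "bij_betw \<gamma> (carrier V) {f. \<forall>u. u \<notin> I \<longrightarrow> f u = 0}"
    and add_closed: "\<lbrakk>v \<in> carrier V; v' \<in> carrier V\<rbrakk> \<Longrightarrow> v \<oplus>\<^bsub>V\<^esub> v' \<in> carrier V"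
    and coord_add: "\<lbrakk>v \<in> carrier V; v' \<in> carrier V\<rbrakk> \<Longrightarrow> \<gamma> (v \<oplus>\<^bsub>V\<^esub> v') u = \<gamma> v u + \<gamma> v' u"
    and smult_closed: "v \<in> carrier V \<Longrightarrow> c \<odot>\<^bsub>V\<^esub> v \<in> carrier V"
    and coord_smult: "v \<in> carrier V \<Longrightarrow> \<gamma> (c \<odot>\<^bsub>V\<^esub> v) u = c * \<gamma> v u"
begin

definition basis :: "'i \<Rightarrow> 'm" where
  "basis u = inv_into (carrier V) \<gamma> (\<lambda>w. if w = u then 1 else 0)"

lemma coord_outside: "v \<in> carrier V \<Longrightarrow> u \<notin> I \<Longrightarrow> \<gamma> v u = 0"
  using bij_betwE[OF coord_bij] by auto

lemma coord_eqI: "\<lbrakk>v \<in> carrier V; v' \<in> carrier V; \<And>u. \<gamma> v u = \<gamma> v' u\<rbrakk> \<Longrightarrow> v = v'"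
  by (rule inj_onD[OF bij_betw_imp_inj_on[OF coord_bij]]) auto

lemma ex_coord:
  assumes "\<And>u. u \<notin> I \<Longrightarrow> f u = 0"
  shows "\<exists>v\<in>carrier V. \<gamma> v = f"
proof -
  have "f \<in> \<gamma> ` carrier V"
    unfolding bij_betw_imp_surj_on[OF coord_bij] using assms by simp
  then show ?thesis by blast
qed

lemma basis:
  assumes "u \<in> I"
  shows basis_closed: "basis u \<in> carrier V"
    and coord_basis: "\<gamma> (basis u) w = (if w = u then 1 else 0)"
proof -
  have "(\<lambda>w. if w = u then 1 else 0) \<in> \<gamma> ` carrier V"
    using assms bij_betw_imp_surj_on[OF coord_bij] by auto
  from inv_into_into[OF this] f_inv_into_f[OF this]
  show "basis u \<in> carrier V" "\<gamma> (basis u) w = (if w = u then 1 else 0)"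
    by (simp_all add: basis_def)
qed

text \<open>
  A map that is linear modulo a subspace \<open>S\<close> satisfies the basis expansion modulo \<open>S\<close>.
  It is applied to \<open>v \<mapsto> (v, w)\<close> and \<open>w \<mapsto> (v, w)\<close>, which are linear in the free space
  modulo the span of the bilinearity relators.
\<close>

lemma expand_in_basis_mod:
  fixes t :: "'m \<Rightarrow> 'f \<Rightarrow>\<^sub>0 'k"
  assumes S: "Modules.module.subspace scale S"
    and t_add: "\<And>v v'. \<lbrakk>v \<in> carrier V; v' \<in> carrier V\<rbrakk> \<Longrightarrow> t (v \<oplus>\<^bsub>V\<^esub> v') - t v - t v' \<in> S"
    and t_smult: "\<And>c v. v \<in> carrier V \<Longrightarrow> t (c \<odot>\<^bsub>V\<^esub> v) - scale c (t v) \<in> S"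
    and v: "v \<in> carrier V"
  shows "t v - (\<Sum>u\<in>I. scale (\<gamma> v u) (t (basis u))) \<in> S"
proof -
  interpret F: vector_space "scale :: 'k \<Rightarrow> ('f \<Rightarrow>\<^sub>0 'k) \<Rightarrow> _" by (rule vector_space_scale)
  have "t v - (\<Sum>u\<in>K. scale (\<gamma> v u) (t (basis u))) \<in> S"
    if "finite K" "K \<subseteq> I" "v \<in> carrier V" "\<And>u. u \<notin> K \<Longrightarrow> \<gamma> v u = 0" for K v
    using that
  proof (induction K arbitrary: v rule: finite_induct)
    case empty
    \<comment> \<open>A vector without coordinates is zero, hence its own multiple by \<open>0\<close>, so \<open>t\<close> sends it into \<open>S\<close>.\<close>
    then have "v = 0 \<odot>\<^bsub>V\<^esub> v" by (intro coord_eqI) (simp_all add: smult_closed coord_smult)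
    with t_smult[of v 0] empty show ?case by simp
  next
    case (insert k K)
    let ?c = "\<gamma> v k"
    have k: "k \<in> I" using insert.prems by simp
    have "((\<gamma> v)(k := 0)) u = 0" if "u \<notin> I" for u
      using coord_outside[OF insert.prems(2) that] by simp
    then obtain v' where v': "v' \<in> carrier V" "\<gamma> v' = (\<gamma> v)(k := 0)"
      using ex_coord by blast
    \<comment> \<open>Split off the component of \<open>v\<close> at \<open>k\<close>; the rest \<open>v'\<close> is covered by the induction hypothesis.\<close>
    let ?b = "?c \<odot>\<^bsub>V\<^esub> basis k"
    have b: "?b \<in> carrier V" using k by (simp add: basis_closed smult_closed)
    have v_eq: "v = v' \<oplus>\<^bsub>V\<^esub> ?b"
      by (rule coord_eqI)
         (use insert.prems v' b k in
           \<open>simp_all add: add_closed coord_add coord_smult basis_closed coord_basis\<close>)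
    have "t v' - (\<Sum>u\<in>K. scale (\<gamma> v' u) (t (basis u))) \<in> S"
      using insert v' by (intro insert.IH) auto
    also have "(\<Sum>u\<in>K. scale (\<gamma> v' u) (t (basis u))) = (\<Sum>u\<in>K. scale (\<gamma> v u) (t (basis u)))"
      using insert.hyps v' by (intro sum.cong) auto
    finally have IH: "t v' - (\<Sum>u\<in>K. scale (\<gamma> v u) (t (basis u))) \<in> S" .
    have "t v - t v' - t ?b \<in> S" using t_add[OF v'(1) b] v_eq by simp
    from F.subspace_add[OF S F.subspace_add[OF S this t_smult[OF basis_closed[OF k]]] IH]
    have "t v - t v' - t ?b + (t ?b - scale ?c (t (basis k)))
      + (t v' - (\<Sum>u\<in>K. scale (\<gamma> v u) (t (basis u)))) \<in> S" .
    then show ?case using insert.hyps by (simp add: algebra_simps)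
  qed
  from this[OF finite_index _ v] show ?thesis using coord_outside v by blast
qed

end

definition tensor_eval ::
  "('m \<Rightarrow> 'i \<Rightarrow> 'k) \<Rightarrow> ('n \<Rightarrow> 'j \<Rightarrow> 'k) \<Rightarrow> ('m \<times> 'n \<Rightarrow>\<^sub>0 'k) \<Rightarrow> 'i \<Rightarrow> 'j \<Rightarrow> 'k::field" where
  "tensor_eval \<gamma> \<gamma>' x = (\<lambda>u w. lin_ext (\<lambda>(m, n). \<gamma> m u * \<gamma>' n w) x)"

text \<open>
  The coordinates of a class are those of any representative, as \<open>tensor_coord_class\<close> below
  shows.
\<close>

definition tensor_coord ::
  "('m \<Rightarrow> 'i \<Rightarrow> 'k) \<Rightarrow> ('n \<Rightarrow> 'j \<Rightarrow> 'k) \<Rightarrow> ('m \<times> 'n \<Rightarrow>\<^sub>0 'k) set \<Rightarrow> 'i \<Rightarrow> 'j \<Rightarrow> 'k::field" where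
  "tensor_coord \<gamma> \<gamma>' X = tensor_eval \<gamma> \<gamma>' (SOME x. x \<in> X)"

lemma tensor_eval_add: "tensor_eval \<gamma> \<gamma>' (x + y) u w = tensor_eval \<gamma> \<gamma>' x u w + tensor_eval \<gamma> \<gamma>' y u w"
  and tensor_eval_diff: "tensor_eval \<gamma> \<gamma>' (x - y) u w = tensor_eval \<gamma> \<gamma>' x u w - tensor_eval \<gamma> \<gamma>' y u w"
  and tensor_eval_scale: "tensor_eval \<gamma> \<gamma>' (scale c x) u w = c * tensor_eval \<gamma> \<gamma>' x u w"
  and tensor_eval_zero: "tensor_eval \<gamma> \<gamma>' 0 u w = 0"
  and tensor_eval_single: "tensor_eval \<gamma> \<gamma>' (Poly_Mapping.single (m, n) c) u w = c * (\<gamma> m u * \<gamma>' n w)"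
  by (simp_all add: tensor_eval_def lin_ext_add lin_ext_diff lin_ext_scale)

lemma poly_mapping_sum_scale:
  "x = (\<Sum>b\<in>Poly_Mapping.keys x. scale (Poly_Mapping.lookup x b) (Poly_Mapping.single b 1))"
  by (rule poly_mapping_eqI)
     (auto simp: lookup_sum lookup_single when_def sum.delta in_keys_iff if_distrib cong: if_cong)

locale tensor_coordinates =
  V: coordinates V \<gamma> I + W: coordinates W \<gamma>' J
  for V :: "('k::field, 'm, 'x) module_scheme" and \<gamma> :: "'m \<Rightarrow> 'i \<Rightarrow> 'k" and I
    and W :: "('k, 'n, 'y) module_scheme" and \<gamma>' :: "'n \<Rightarrow> 'j \<Rightarrow> 'k" and J
begin

abbreviation "relator_span \<equiv> Modules.module.span scale (tensor_relators V W)"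

sublocale free: vector_space "scale :: 'k \<Rightarrow> ('m \<times> 'n \<Rightarrow>\<^sub>0 'k) \<Rightarrow> _"
  by (rule vector_space_scale)

text \<open>
  The representative of a class that is supported on pairs of basis vectors.
\<close>

definition normal_form :: "('m \<times> 'n \<Rightarrow>\<^sub>0 'k) \<Rightarrow> ('m \<times> 'n \<Rightarrow>\<^sub>0 'k)" where
  "normal_form x = (\<Sum>u\<in>I. \<Sum>w\<in>J. scale (tensor_eval \<gamma> \<gamma>' x u w)
     (Poly_Mapping.single (V.basis u, W.basis w) 1))"

lemma normal_form_add: "normal_form (x + y) = normal_form x + normal_form y"
  by (simp add: normal_form_def tensor_eval_add free.scale_left_distrib sum.distrib)

lemma normal_form_scale: "normal_form (scale c x) = scale c (normal_form x)"
  by (simp add: normal_form_def tensor_eval_scale free.scale_sum_right)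

lemma normal_form_sum: "normal_form (\<Sum>i\<in>S. x i) = (\<Sum>i\<in>S. normal_form (x i))"
  by (induction S rule: infinite_finite_induct)
     (auto simp: normal_form_add, simp_all add: normal_form_def tensor_eval_zero)

lemma elementary_normal_form:
  assumes m: "m \<in> carrier V" and n: "n \<in> carrier W"
  shows "Poly_Mapping.single (m, n) 1 - normal_form (Poly_Mapping.single (m, n) 1) \<in> relator_span"
proof -
  let ?s = "\<lambda>m n. Poly_Mapping.single (m, n) (1 :: 'k)"
  have sc: "Poly_Mapping.single (m, n) c = scale c (?s m n)" for m n c
    by (simp add: scale_single)
  have left: "?s m n - (\<Sum>u\<in>I. scale (\<gamma> m u) (?s (V.basis u) n)) \<in> relator_span"
  proof (rule V.expand_in_basis_mod[OF free.subspace_span _ _ m])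
    show "?s (v \<oplus>\<^bsub>V\<^esub> v') n - ?s v n - ?s v' n \<in> relator_span"
      if "v \<in> carrier V" "v' \<in> carrier V" for v v'
      using that n by (intro free.span_base) (auto simp: tensor_relators_def)
    show "?s (c \<odot>\<^bsub>V\<^esub> v) n - scale c (?s v n) \<in> relator_span" if "v \<in> carrier V" for c v
      using that n unfolding sc[symmetric]
      by (intro free.span_base) (auto simp: tensor_relators_def)
  qed
  have right: "?s m n - (\<Sum>w\<in>J. scale (\<gamma>' n w) (?s m (W.basis w))) \<in> relator_span"
    if m: "m \<in> carrier V" for m
  proof (rule W.expand_in_basis_mod[OF free.subspace_span _ _ n])
    show "?s m (v \<oplus>\<^bsub>W\<^esub> v') - ?s m v - ?s m v' \<in> relator_span"
      if "v \<in> carrier W" "v' \<in> carrier W" for v v'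
      using that m by (intro free.span_base) (auto simp: tensor_relators_def)
    show "?s m (c \<odot>\<^bsub>W\<^esub> v) - scale c (?s m v) \<in> relator_span" if "v \<in> carrier W" for c v
      using that m unfolding sc[symmetric]
      by (intro free.span_base) (auto simp: tensor_relators_def)
  qed
  have "(\<Sum>u\<in>I. scale (\<gamma> m u) (?s (V.basis u) n - (\<Sum>w\<in>J. scale (\<gamma>' n w) (?s (V.basis u) (W.basis w)))))
      \<in> relator_span"
    by (intro free.span_sum free.span_scale right V.basis_closed)
  from free.span_add[OF left this] show ?thesis
    by (simp add: normal_form_def tensor_eval_single free.scale_right_diff_distrib
        sum_subtractf free.scale_sum_right)
qed

lemma normal_form_mod_relators:
  assumes "x \<in> tensor_free V W"
  shows "x - normal_form x \<in> relator_span"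
proof -
  let ?s = "\<lambda>b. Poly_Mapping.single b (1 :: 'k)"
  have "x - normal_form x =
    (\<Sum>b\<in>Poly_Mapping.keys x. scale (Poly_Mapping.lookup x b) (?s b - normal_form (?s b)))"
    by (subst (1 2) poly_mapping_sum_scale[of x])
       (simp only: normal_form_sum normal_form_scale free.scale_right_diff_distrib sum_subtractf)
  also have "\<dots> \<in> relator_span"
    using assms elementary_normal_form
    by (intro free.span_sum free.span_scale) (auto simp: tensor_free_def)
  finally show ?thesis .
qed

lemma tensor_eval_relator_span:
  assumes "x \<in> relator_span"
  shows "tensor_eval \<gamma> \<gamma>' x u w = 0"
proof -
  let ?K = "{x. tensor_eval \<gamma> \<gamma>' x u w = 0}"
  have "tensor_relators V W \<subseteq> ?K"
    by (auto simp: tensor_relators_def tensor_eval_diff tensor_eval_single V.coord_add W.coord_add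
        V.coord_smult W.coord_smult distrib_left distrib_right mult_ac)
  moreover have "free.subspace ?K"
    by (auto simp: free.subspace_def tensor_eval_zero tensor_eval_add tensor_eval_scale)
  ultimately have "relator_span \<subseteq> ?K" by (rule free.span_minimal)
  with assms show ?thesis by auto
qed

lemma tensor_free_closed:
  "0 \<in> tensor_free V W"
  "x \<in> tensor_free V W \<Longrightarrow> y \<in> tensor_free V W \<Longrightarrow> x + y \<in> tensor_free V W"
  "x \<in> tensor_free V W \<Longrightarrow> y \<in> tensor_free V W \<Longrightarrow> x - y \<in> tensor_free V W"
  "x \<in> tensor_free V W \<Longrightarrow> scale c x \<in> tensor_free V W"
  using keys_add[of x y] keys_diff[of x y] keys_scale[of c x] by (auto simp: tensor_free_def)

text \<open>
  Two formal sums with equal coordinates have the same normal form, so they agree modulo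
  the relators.  The tensor product thereby becomes a space of matrices.
\<close>

lemma tensor_rel_iff:
  "(x, y) \<in> tensor_rel V W \<longleftrightarrow>
     x \<in> tensor_free V W \<and> y \<in> tensor_free V W \<and> tensor_eval \<gamma> \<gamma>' x = tensor_eval \<gamma> \<gamma>' y"
proof -
  have "x - y \<in> relator_span \<longleftrightarrow> tensor_eval \<gamma> \<gamma>' x = tensor_eval \<gamma> \<gamma>' y"
    if "x \<in> tensor_free V W" "y \<in> tensor_free V W"
  proof
    assume "x - y \<in> relator_span"
    from tensor_eval_relator_span[OF this] show "tensor_eval \<gamma> \<gamma>' x = tensor_eval \<gamma> \<gamma>' y"
      by (simp add: fun_eq_iff tensor_eval_diff)
  next
    assume "tensor_eval \<gamma> \<gamma>' x = tensor_eval \<gamma> \<gamma>' y"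
    then have "normal_form (x - y) = 0" by (simp add: normal_form_def tensor_eval_diff)
    with normal_form_mod_relators[OF tensor_free_closed(3)[OF that]] show "x - y \<in> relator_span"
      by simp
  qed
  then show ?thesis by (auto simp: tensor_rel_def)
qed

lemma tensor_class:
  "x \<in> tensor_free V W \<Longrightarrow>
     tensor_rel V W `` {x} = {y \<in> tensor_free V W. tensor_eval \<gamma> \<gamma>' y = tensor_eval \<gamma> \<gamma>' x}"
  by (auto simp: tensor_rel_iff)

lemma tensor_coord_class:
  assumes "x \<in> tensor_free V W"
  shows "tensor_coord \<gamma> \<gamma>' (tensor_rel V W `` {x}) = tensor_eval \<gamma> \<gamma>' x"
proof -
  let ?X = "tensor_rel V W `` {x}"
  have "x \<in> ?X" using assms by (simp add: tensor_class)
  then have "(SOME x. x \<in> ?X) \<in> ?X" by (rule someI)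
  then show ?thesis using assms by (simp add: tensor_coord_def tensor_class)
qed

lemma tensor_eval_image: "tensor_eval \<gamma> \<gamma>' ` tensor_free V W = {F. \<forall>u w. (u, w) \<notin> I \<times> J \<longrightarrow> F u w = 0}"
proof (intro equalityI subsetI)
  fix F assume "F \<in> tensor_eval \<gamma> \<gamma>' ` tensor_free V W"
  then show "F \<in> {F. \<forall>u w. (u, w) \<notin> I \<times> J \<longrightarrow> F u w = 0}"
    by (auto simp: tensor_eval_def lin_ext_def tensor_free_def V.coord_outside W.coord_outside
        intro!: sum.neutral)
next
  fix F :: "'i \<Rightarrow> 'j \<Rightarrow> 'k"
  assume F: "F \<in> {F. \<forall>u w. (u, w) \<notin> I \<times> J \<longrightarrow> F u w = 0}"
  define x where "x = (\<Sum>(u, w)\<in>I \<times> J. Poly_Mapping.single (V.basis u, W.basis w) (F u w))"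
  have "x \<in> tensor_free V W"
    unfolding x_def tensor_free_def
    by (force dest!: subsetD[OF keys_sum] split: if_splits simp: V.basis_closed W.basis_closed)
  moreover have "tensor_eval \<gamma> \<gamma>' x u w = F u w" for u w
  proof -
    have "tensor_eval \<gamma> \<gamma>' x u w = (\<Sum>(u', w')\<in>I \<times> J. if (u', w') = (u, w) then F u w else 0)"
      unfolding x_def tensor_eval_def lin_ext_sum
      by (intro sum.cong) (auto simp: V.coord_basis W.coord_basis split: if_splits)
    also have "\<dots> = (\<Sum>p\<in>I \<times> J. if p = (u, w) then F u w else 0)"
      by (intro sum.cong) (auto split: if_splits)
    also have "\<dots> = F u w"
      using F V.finite_index W.finite_index by (auto simp: sum.delta)
    finally show ?thesis .
  qed
  ultimately show "F \<in> tensor_eval \<gamma> \<gamma>' ` tensor_free V W" by (metis ext image_eqI)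
qed

lemma tensor_coord_bij:
  "bij_betw (tensor_coord \<gamma> \<gamma>') (tensor_free V W // tensor_rel V W)
     {F. \<forall>u w. (u, w) \<notin> I \<times> J \<longrightarrow> F u w = 0}"
proof (rule bij_betw_imageI)
  show "inj_on (tensor_coord \<gamma> \<gamma>') (tensor_free V W // tensor_rel V W)"
  proof (rule inj_onI)
    fix X Y
    assume "X \<in> tensor_free V W // tensor_rel V W" "Y \<in> tensor_free V W // tensor_rel V W"
      and eq: "tensor_coord \<gamma> \<gamma>' X = tensor_coord \<gamma> \<gamma>' Y"
    then obtain x y where "x \<in> tensor_free V W" "X = tensor_rel V W `` {x}"
      "y \<in> tensor_free V W" "Y = tensor_rel V W `` {y}"
      by (auto elim!: quotientE)
    with eq show "X = Y" by (simp add: tensor_coord_class) (simp add: tensor_class)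
  qed
  have "tensor_coord \<gamma> \<gamma>' ` (tensor_free V W // tensor_rel V W)
      = (\<lambda>x. tensor_coord \<gamma> \<gamma>' (tensor_rel V W `` {x})) ` tensor_free V W"
    by (simp add: quotient_def image_UN UNION_singleton_eq_range image_image)
  also have "\<dots> = tensor_eval \<gamma> \<gamma>' ` tensor_free V W"
    by (rule image_cong) (simp_all add: tensor_coord_class)
  finally have "tensor_coord \<gamma> \<gamma>' ` (tensor_free V W // tensor_rel V W)
      = tensor_eval \<gamma> \<gamma>' ` tensor_free V W" .
  then show "tensor_coord \<gamma> \<gamma>' ` (tensor_free V W // tensor_rel V W)
      = {F. \<forall>u w. (u, w) \<notin> I \<times> J \<longrightarrow> F u w = 0}"
    by (simp add: tensor_eval_image)
qed

text \<open>
  The operations on the tensor product are defined by unions over all representatives.  Such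
  a union is a single class as soon as the coordinates of \<open>h y\<close> are a function of those
  of \<open>y\<close>.
\<close>

lemma induced_map_on_class:
  assumes x: "x \<in> tensor_free V W"
    and closed: "\<And>y. y \<in> tensor_free V W \<Longrightarrow> h y \<in> tensor_free V W"
    and eval: "\<And>y. y \<in> tensor_free V W \<Longrightarrow> tensor_eval \<gamma> \<gamma>' (h y) = H (tensor_eval \<gamma> \<gamma>' y)"
  shows "(\<Union>y\<in>tensor_rel V W `` {x}. tensor_rel V W `` {h y}) = tensor_rel V W `` {h x}"
proof (rule SUP_eq_const)
  show "tensor_rel V W `` {x} \<noteq> {}" using x by (auto simp: tensor_rel_iff)
  show "tensor_rel V W `` {h y} = tensor_rel V W `` {h x}" if "y \<in> tensor_rel V W `` {x}" for y
  proof -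
    from that have "y \<in> tensor_free V W" "tensor_eval \<gamma> \<gamma>' x = tensor_eval \<gamma> \<gamma>' y"
      by (auto simp: tensor_rel_iff)
    then show ?thesis using x by (simp add: tensor_class closed eval)
  qed
qed

lemma add_on_classes:
  assumes "x \<in> tensor_free V W" "y \<in> tensor_free V W"
  shows "(\<Union>x'\<in>tensor_rel V W `` {x}. \<Union>y'\<in>tensor_rel V W `` {y}. tensor_rel V W `` {x' + y'})
    = tensor_rel V W `` {x + y}"
proof -
  have "(\<Union>y'\<in>tensor_rel V W `` {y}. tensor_rel V W `` {x' + y'}) = tensor_rel V W `` {x' + y}"
    if "x' \<in> tensor_free V W" for x'
    by (rule induced_map_on_class[where H = "\<lambda>F u w. tensor_eval \<gamma> \<gamma>' x' u w + F u w"])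
       (use that assms in \<open>auto simp: tensor_free_closed tensor_eval_add intro!: ext\<close>)
  then have "(\<Union>x'\<in>tensor_rel V W `` {x}. \<Union>y'\<in>tensor_rel V W `` {y}. tensor_rel V W `` {x' + y'})
    = (\<Union>x'\<in>tensor_rel V W `` {x}. tensor_rel V W `` {x' + y})"
    by (intro SUP_cong) (auto simp: tensor_rel_iff)
  also have "\<dots> = tensor_rel V W `` {x + y}"
    by (rule induced_map_on_class[where H = "\<lambda>F u w. F u w + tensor_eval \<gamma> \<gamma>' y u w"])
       (use assms in \<open>auto simp: tensor_free_closed tensor_eval_add intro!: ext\<close>)
  finally show ?thesis .
qed

end

section \<open>Bimodules modelled by matrices\<close>

text \<open>
  A bimodule that is, through \<open>\<kappa>\<close>, the space of all matrices supported on \<open>P\<close>, with the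
  path algebra acting by matrix multiplication on either side.
\<close>

locale matrix_model =
  fixes Q :: "('v, 'e) pre_digraph"
    and M :: "('k::field, ('k, 'v, 'e) palg, 'm) bimodule"
    and \<kappa> :: "'m \<Rightarrow> 'v \<Rightarrow> 'v \<Rightarrow> 'k" and P :: "('v \<times> 'v) set"
  assumes bij: "bij_betw \<kappa> (carrier M) (matrices_on P)"
    and zero_closed: "\<zero>\<^bsub>M\<^esub> \<in> carrier M"
    and coord_zero: "\<kappa> \<zero>\<^bsub>M\<^esub> u w = 0"
    and add_closed: "\<lbrakk>x \<in> carrier M; y \<in> carrier M\<rbrakk> \<Longrightarrow> x \<oplus>\<^bsub>M\<^esub> y \<in> carrier M"
    and coord_add: "\<lbrakk>x \<in> carrier M; y \<in> carrier M\<rbrakk> \<Longrightarrow> \<kappa> (x \<oplus>\<^bsub>M\<^esub> y) u w = \<kappa> x u w + \<kappa> y u w"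
    and smult_closed: "x \<in> carrier M \<Longrightarrow> c \<odot>\<^bsub>M\<^esub> x \<in> carrier M"
    and coord_smult: "x \<in> carrier M \<Longrightarrow> \<kappa> (c \<odot>\<^bsub>M\<^esub> x) u w = c * \<kappa> x u w"
    and blact_closed: "\<lbrakk>a \<in> carrier (path_algebra Q); x \<in> carrier M\<rbrakk> \<Longrightarrow> blact M a x \<in> carrier M"
    and coord_blact: "\<lbrakk>a \<in> carrier (path_algebra Q); x \<in> carrier M\<rbrakk>
      \<Longrightarrow> \<kappa> (blact M a x) = mat_mult Q (path_matrix a) (\<kappa> x)"
    and bract_closed: "\<lbrakk>a \<in> carrier (path_algebra Q); x \<in> carrier M\<rbrakk> \<Longrightarrow> bract M x a \<in> carrier M"
    and coord_bract: "\<lbrakk>a \<in> carrier (path_algebra Q); x \<in> carrier M\<rbrakk>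
      \<Longrightarrow> \<kappa> (bract M x a) = mat_mult Q (\<kappa> x) (path_matrix a)"

text \<open>
  Left modules correspond to column vectors and right modules to row vectors, so that their
  outer tensor product consists of matrices.
\<close>

locale left_coordinates = coordinates V \<gamma> "I :: 'v set"
  for Q :: "('v, 'e) pre_digraph"
    and V :: "('k::field, ('k, 'v, 'e) palg, 'm) left_module" and \<gamma> I +
  assumes lact_closed: "\<lbrakk>a \<in> carrier (path_algebra Q); m \<in> carrier V\<rbrakk> \<Longrightarrow> lact V a m \<in> carrier V"
    and coord_lact: "\<lbrakk>a \<in> carrier (path_algebra Q); m \<in> carrier V\<rbrakk>
      \<Longrightarrow> \<gamma> (lact V a m) u = (\<Sum>z\<in>verts Q. path_matrix a u z * \<gamma> m z)"

locale right_coordinates = coordinates W \<gamma> "J :: 'v set"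
  for Q :: "('v, 'e) pre_digraph"
    and W :: "('k::field, ('k, 'v, 'e) palg, 'n) right_module" and \<gamma> J +
  assumes ract_closed: "\<lbrakk>a \<in> carrier (path_algebra Q); n \<in> carrier W\<rbrakk> \<Longrightarrow> ract W n a \<in> carrier W"
    and coord_ract: "\<lbrakk>a \<in> carrier (path_algebra Q); n \<in> carrier W\<rbrakk>
      \<Longrightarrow> \<gamma> (ract W n a) w = (\<Sum>z\<in>verts Q. \<gamma> n z * path_matrix a z w)"

text \<open>
  A column times a row is a matrix of rank one; multiplying the column from the left or the
  row from the right is the same as multiplying that matrix, and such matrices span.
\<close>

lemma tensor_matrix_model:
  fixes Q :: "('v, 'e) pre_digraph"
    and V :: "('k::field, ('k, 'v, 'e) palg, 'm) left_module"
    and W :: "('k, ('k, 'v, 'e) palg, 'n) right_module"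
  assumes "left_coordinates Q V \<gamma> I" and "right_coordinates Q W \<gamma>' J"
  shows "matrix_model Q (tensor_bimodule V W) (tensor_coord \<gamma> \<gamma>') (I \<times> J)"
proof -
  interpret V: left_coordinates Q V \<gamma> I by fact
  interpret W: right_coordinates Q W \<gamma>' J by fact
  interpret tensor_coordinates V \<gamma> I W \<gamma>' J ..
  let ?T = "tensor_bimodule V W" and ?F = "tensor_free V W" and ?A = "carrier (path_algebra Q) :: ('k, 'v, 'e) palg set"
  let ?ev = "tensor_eval \<gamma> \<gamma>'" and ?\<kappa> = "tensor_coord \<gamma> \<gamma>'"
  let ?cl = "\<lambda>x. tensor_rel V W `` {x}"
  let ?l = "\<lambda>a. free_map (\<lambda>(m, n). (lact V a m, n))"
  let ?r = "\<lambda>a. free_map (\<lambda>(m, n). (m, ract W n a))"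
  have carr: "X \<in> carrier ?T \<longleftrightarrow> (\<exists>x\<in>?F. X = ?cl x)" for X
    by (auto simp: tensor_bimodule_def quotient_def)
  have l_closed: "?l a x \<in> ?F" if "a \<in> ?A" "x \<in> ?F" for a x
    using that V.lact_closed keys_free_map[of "\<lambda>(m, n). (lact V a m, n)" x]
    by (fastforce simp: tensor_free_def)
  have r_closed: "?r a x \<in> ?F" if "a \<in> ?A" "x \<in> ?F" for a x
    using that W.ract_closed keys_free_map[of "\<lambda>(m, n). (m, ract W n a)" x]
    by (fastforce simp: tensor_free_def)
  have l_eval: "?ev (?l a x) = mat_mult Q (path_matrix a) (?ev x)" if a: "a \<in> ?A" and x: "x \<in> ?F" for a x
  proof (intro ext)
    fix u w
    have "?ev (?l a x) u w = lin_ext (\<lambda>b. \<Sum>z\<in>verts Q. path_matrix a u z * (case b of (m, n) \<Rightarrow> \<gamma> m z * \<gamma>' n w)) x"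
      unfolding tensor_eval_def lin_ext_free_map
      using a x by (intro lin_ext_cong) (auto simp: tensor_free_def V.coord_lact sum_distrib_right mult.assoc)
    then show "?ev (?l a x) u w = mat_mult Q (path_matrix a) (?ev x) u w"
      by (simp add: lin_ext_sum_fun mat_mult_def tensor_eval_def)
  qed
  have r_eval: "?ev (?r a x) = mat_mult Q (?ev x) (path_matrix a)" if a: "a \<in> ?A" and x: "x \<in> ?F" for a x
  proof (intro ext)
    fix u w
    have "?ev (?r a x) u w = lin_ext (\<lambda>b. \<Sum>z\<in>verts Q. path_matrix a z w * (case b of (m, n) \<Rightarrow> \<gamma> m u * \<gamma>' n z)) x"
      unfolding tensor_eval_def lin_ext_free_map
      using a x by (intro lin_ext_cong) (auto simp: tensor_free_def W.coord_ract sum_distrib_left mult_ac)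
    then show "?ev (?r a x) u w = mat_mult Q (?ev x) (path_matrix a) u w"
      by (simp add: lin_ext_sum_fun mat_mult_def tensor_eval_def mult.commute)
  qed
  have zero: "\<zero>\<^bsub>?T\<^esub> = ?cl 0" by (simp add: tensor_bimodule_def)
  have add: "?cl x \<oplus>\<^bsub>?T\<^esub> ?cl y = ?cl (x + y)" if "x \<in> ?F" "y \<in> ?F" for x y
    unfolding tensor_bimodule_def using add_on_classes[OF that] by simp
  have smult: "c \<odot>\<^bsub>?T\<^esub> ?cl x = ?cl (scale c x)" if "x \<in> ?F" for c x
    unfolding tensor_bimodule_def
    using induced_map_on_class[OF that, of "scale c" "\<lambda>F u w. c * F u w"]
    by (simp add: tensor_free_closed tensor_eval_scale fun_eq_iff)
  have blact: "blact ?T a (?cl x) = ?cl (?l a x)" if "a \<in> ?A" "x \<in> ?F" for a x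
    unfolding tensor_bimodule_def
    using induced_map_on_class[of x "?l a" "mat_mult Q (path_matrix a)",
        OF that(2) l_closed[OF that(1)] l_eval[OF that(1)]] by simp
  have bract: "bract ?T (?cl x) a = ?cl (?r a x)" if "a \<in> ?A" "x \<in> ?F" for a x
    unfolding tensor_bimodule_def
    using induced_map_on_class[of x "?r a" "\<lambda>F. mat_mult Q F (path_matrix a)",
        OF that(2) r_closed[OF that(1)] r_eval[OF that(1)]] by simp
  show ?thesis
  proof
    show "bij_betw ?\<kappa> (carrier ?T) (matrices_on (I \<times> J))"
      using tensor_coord_bij by (simp add: tensor_bimodule_def matrices_on_def)
    show "\<zero>\<^bsub>?T\<^esub> \<in> carrier ?T" "?\<kappa> \<zero>\<^bsub>?T\<^esub> u w = 0" for u w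
      by (auto simp: carr zero tensor_coord_class tensor_free_closed tensor_eval_zero)
    show "X \<oplus>\<^bsub>?T\<^esub> Y \<in> carrier ?T" "?\<kappa> (X \<oplus>\<^bsub>?T\<^esub> Y) u w = ?\<kappa> X u w + ?\<kappa> Y u w"
      if "X \<in> carrier ?T" "Y \<in> carrier ?T" for X Y u w
    proof -
      from that obtain x y where "x \<in> ?F" "X = ?cl x" "y \<in> ?F" "Y = ?cl y" by (auto simp: carr)
      moreover from this have "x + y \<in> ?F" by (simp add: tensor_free_closed)
      ultimately show "X \<oplus>\<^bsub>?T\<^esub> Y \<in> carrier ?T" "?\<kappa> (X \<oplus>\<^bsub>?T\<^esub> Y) u w = ?\<kappa> X u w + ?\<kappa> Y u w"
        unfolding carr by (auto simp: add tensor_coord_class tensor_eval_add)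
    qed
    fix X assume "X \<in> carrier ?T"
    then obtain x where x: "x \<in> ?F" "X = ?cl x" by (auto simp: carr)
    show "c \<odot>\<^bsub>?T\<^esub> X \<in> carrier ?T" "?\<kappa> (c \<odot>\<^bsub>?T\<^esub> X) u w = c * ?\<kappa> X u w" for c u w
      using x tensor_free_closed(4)[OF x(1), of c] unfolding carr
      by (auto simp: smult tensor_coord_class tensor_eval_scale)
    fix a assume a: "a \<in> ?A"
    show "blact ?T a X \<in> carrier ?T" "?\<kappa> (blact ?T a X) = mat_mult Q (path_matrix a) (?\<kappa> X)"
      using x a l_closed[OF a x(1)] l_eval[OF a x(1)] unfolding carr
      by (auto simp: blact tensor_coord_class)
    show "bract ?T X a \<in> carrier ?T" "?\<kappa> (bract ?T X a) = mat_mult Q (?\<kappa> X) (path_matrix a)"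
      using x a r_closed[OF a x(1)] r_eval[OF a x(1)] unfolding carr
      by (auto simp: bract tensor_coord_class)
  qed
qed

section \<open>The matrix models of the bimodules\<close>

context fin_digraph
begin

lemma path_matrix_row_action:
  assumes "a \<in> carrier (path_algebra G)"
  shows "(\<Sum>z\<in>verts G. path_matrix a u z * f z) =
    (\<Sum>p | p \<in> Poly_Mapping.keys a \<and> ptarget p = u. Poly_Mapping.lookup a p * f (psource p))"
proof -
  have "(\<Sum>z\<in>verts G. path_matrix a u z * f z) =
    (\<Sum>p\<in>Poly_Mapping.keys a. \<Sum>z\<in>verts G.
       Poly_Mapping.lookup a p * elem_matrix (ptarget p) (psource p) 1 u z * f z)"
    unfolding path_matrix_def lin_ext_def sum_distrib_right by (rule sum.swap)
  also have "\<dots> = (\<Sum>p\<in>Poly_Mapping.keys a.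
       if ptarget p = u then Poly_Mapping.lookup a p * f (psource p) else 0)"
  proof (rule sum.cong)
    fix p assume "p \<in> Poly_Mapping.keys a"
    then have "psource p \<in> verts G"
      using assms qpath_ends_in_verts(1)[of p] by (auto simp: path_algebra_def)
    moreover have "(\<Sum>z\<in>verts G. Poly_Mapping.lookup a p * elem_matrix (ptarget p) (psource p) 1 u z * f z)
      = (\<Sum>z\<in>verts G. if z = psource p then
          (if ptarget p = u then Poly_Mapping.lookup a p * f (psource p) else 0) else 0)"
      by (intro sum.cong) (auto simp: elem_matrix_def)
    ultimately show "(\<Sum>z\<in>verts G. Poly_Mapping.lookup a p * elem_matrix (ptarget p) (psource p) 1 u z * f z)
      = (if ptarget p = u then Poly_Mapping.lookup a p * f (psource p) else 0)"
      by (simp add: sum.delta)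
  qed simp
  finally show ?thesis by (simp add: sum.inter_filter)
qed

lemma path_matrix_column_action:
  assumes "a \<in> carrier (path_algebra G)"
  shows "(\<Sum>z\<in>verts G. f z * path_matrix a z w) =
    (\<Sum>p | p \<in> Poly_Mapping.keys a \<and> psource p = w. Poly_Mapping.lookup a p * f (ptarget p))"
proof -
  have "(\<Sum>z\<in>verts G. f z * path_matrix a z w) =
    (\<Sum>p\<in>Poly_Mapping.keys a. \<Sum>z\<in>verts G.
       f z * (Poly_Mapping.lookup a p * elem_matrix (ptarget p) (psource p) 1 z w))"
    unfolding path_matrix_def lin_ext_def sum_distrib_left by (rule sum.swap)
  also have "\<dots> = (\<Sum>p\<in>Poly_Mapping.keys a.
       if psource p = w then Poly_Mapping.lookup a p * f (ptarget p) else 0)"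
  proof (rule sum.cong)
    fix p assume "p \<in> Poly_Mapping.keys a"
    then have "ptarget p \<in> verts G"
      using assms qpath_ends_in_verts(2)[of p] by (auto simp: path_algebra_def)
    moreover have "(\<Sum>z\<in>verts G. f z * (Poly_Mapping.lookup a p * elem_matrix (ptarget p) (psource p) 1 z w))
      = (\<Sum>z\<in>verts G. if z = ptarget p then
          (if psource p = w then Poly_Mapping.lookup a p * f (ptarget p) else 0) else 0)"
      by (intro sum.cong) (auto simp: elem_matrix_def)
    ultimately show "(\<Sum>z\<in>verts G. f z * (Poly_Mapping.lookup a p * elem_matrix (ptarget p) (psource p) 1 z w))
      = (if psource p = w then Poly_Mapping.lookup a p * f (ptarget p) else 0)"
      by (simp add: sum.delta)
  qed simp
  finally show ?thesis by (simp add: sum.inter_filter)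
qed

lemma natural_left_coordinates:
  "left_coordinates G (natural_left_module G :: ('k::field, ('k, 'a, 'b) palg, 'a \<Rightarrow> 'k) left_module)
     (\<lambda>x. x) (verts G)"
proof
  fix a :: "('k, 'a, 'b) palg" and m :: "'a \<Rightarrow> 'k" and u
  assume a: "a \<in> carrier (path_algebra G)"
  have fold_id': "fold (\<lambda>e. id) es = (id :: 'k \<Rightarrow> 'k)" for es :: "'b list"
    by (induction es) auto
  show "lact (natural_left_module G) a m u = (\<Sum>z\<in>verts G. path_matrix a u z * m z)"
    unfolding path_matrix_row_action[OF a]
    by (simp add: natural_left_module_def left_module_of_rep_def fold_id')
  show "lact (natural_left_module G) a m \<in> carrier (natural_left_module G)"
    using a qpath_ends_in_verts(2)
    by (auto simp: natural_left_module_def left_module_of_rep_def rep_space_def path_algebra_def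
        simp del: split_paired_All intro!: sum.neutral)
qed (auto simp: natural_left_module_def left_module_of_rep_def rep_space_def bij_betw_def)

lemma natural_right_coordinates:
  "right_coordinates G (natural_right_module G :: ('k::field, ('k, 'a, 'b) palg, 'a \<Rightarrow> 'k) right_module)
     (\<lambda>x. x) (verts G)"
proof
  fix a :: "('k, 'a, 'b) palg" and m :: "'a \<Rightarrow> 'k" and u
  assume a: "a \<in> carrier (path_algebra G)"
  have foldr_id': "foldr (\<lambda>e. id) es = (id :: 'k \<Rightarrow> 'k)" for es :: "'b list"
    by (induction es) auto
  show "ract (natural_right_module G) m a u = (\<Sum>z\<in>verts G. m z * path_matrix a z u)"
    unfolding path_matrix_column_action[OF a]
    by (simp add: natural_right_module_def right_module_of_rep_def foldr_id')
  show "ract (natural_right_module G) m a \<in> carrier (natural_right_module G)"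
    using a qpath_ends_in_verts(1)
    by (auto simp: natural_right_module_def right_module_of_rep_def rep_space_def path_algebra_def
        simp del: split_paired_All intro!: sum.neutral)
qed (auto simp: natural_right_module_def right_module_of_rep_def rep_space_def bij_betw_def)

lemma natural_matrix_model:
  "matrix_model G (natural_bimodule G) (tensor_coord (\<lambda>x. x) (\<lambda>x. x)) (verts G \<times> verts G)"
  unfolding natural_bimodule_def
  by (rule tensor_matrix_model[OF natural_left_coordinates natural_right_coordinates])

end

context unique_path_quiver
begin

lemma path_matrix_eqI:
  "\<lbrakk>a \<in> carrier (path_algebra Q); b \<in> carrier (path_algebra Q); \<And>u w. path_matrix a u w = path_matrix b u w\<rbrakk>
     \<Longrightarrow> a = b"
  by (rule inj_onD[OF bij_betw_imp_inj_on[OF path_matrix_bij]]) auto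

lemma ex_path_matrix:
  fixes F :: "'v \<Rightarrow> 'v \<Rightarrow> 'k::field"
  assumes "F \<in> matrices_on (reach Q)"
  shows "\<exists>a\<in>carrier (path_algebra Q). path_matrix a = F"
  using assms unfolding bij_betw_imp_surj_on[OF path_matrix_bij, symmetric] by blast

text \<open>
  Right multiplication by the idempotent at \<open>i\<close> keeps column \<open>i\<close> of a matrix and deletes
  the others; since the representation is faithful, this describes the left ideal.
\<close>

lemma left_projective_carrier:
  assumes i: "i \<in> verts Q"
  shows "carrier (left_projective Q i) =
    {a \<in> carrier (path_algebra Q). \<forall>u w. w \<noteq> i \<longrightarrow> path_matrix a u w = (0 :: 'k::field)}"
    (is "_ = ?R")
proof -
  let ?A = "carrier (path_algebra Q) :: ('k, 'v, 'e) palg set"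
  let ?mult = "\<lambda>a. a \<otimes>\<^bsub>path_algebra Q\<^esub> (trivial_path i :: ('k, 'v, 'e) palg)"
  have closed: "?mult a \<in> ?A" if "a \<in> ?A" for a
    using that i by (intro path_algebra_mult_closed trivial_path_closed)
  have mat: "path_matrix (?mult a) u w = (if w = i then path_matrix a u i else 0)" if "a \<in> ?A" for a u w
    using i by (simp add: path_matrix_mult[OF that trivial_path_closed] path_matrix_trivial_path
        elem_matrix_mult)
  have "?mult a = a" if "a \<in> ?R" for a
    using that by (intro path_matrix_eqI) (auto simp: closed mat)
  then have "?R \<subseteq> ?mult ` ?A" by (metis (no_types, lifting) image_eqI mem_Collect_eq subsetI)
  moreover have "?mult ` ?A \<subseteq> ?R" using closed mat by auto
  ultimately show ?thesis by (simp add: left_projective_def Setcompr_eq_image)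
qed

lemma right_projective_carrier:
  assumes j: "j \<in> verts Q"
  shows "carrier (right_projective Q j) =
    {a \<in> carrier (path_algebra Q). \<forall>u w. u \<noteq> j \<longrightarrow> path_matrix a u w = (0 :: 'k::field)}"
    (is "_ = ?R")
proof -
  let ?A = "carrier (path_algebra Q) :: ('k, 'v, 'e) palg set"
  let ?mult = "\<lambda>a. (trivial_path j :: ('k, 'v, 'e) palg) \<otimes>\<^bsub>path_algebra Q\<^esub> a"
  have closed: "?mult a \<in> ?A" if "a \<in> ?A" for a
    using that j by (intro path_algebra_mult_closed trivial_path_closed)
  have mat: "path_matrix (?mult a) u w = (if u = j then path_matrix a j w else 0)" if "a \<in> ?A" for a u w
    using j by (simp add: path_matrix_mult[OF trivial_path_closed that] path_matrix_trivial_path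
        elem_matrix_mult)
  have "?mult a = a" if "a \<in> ?R" for a
    using that by (intro path_matrix_eqI) (auto simp: closed mat)
  then have "?R \<subseteq> ?mult ` ?A" by (metis (no_types, lifting) image_eqI mem_Collect_eq subsetI)
  moreover have "?mult ` ?A \<subseteq> ?R" using closed mat by auto
  ultimately show ?thesis by (simp add: right_projective_def Setcompr_eq_image)
qed

text \<open>
  The left ideal embeds into the natural module as column \<open>i\<close>, with the vertices that can be
  reached from \<open>i\<close> as support.
\<close>

lemma left_projective_coordinates:
  assumes i: "i \<in> verts Q"
  shows "left_coordinates Q (left_projective Q i :: ('k::field, ('k, 'v, 'e) palg, ('k, 'v, 'e) palg) left_module)
    (\<lambda>a u. path_matrix a u i) {u. (u, i) \<in> reach Q}"
proof -
  let ?V = "left_projective Q i :: ('k, ('k, 'v, 'e) palg, ('k, 'v, 'e) palg) left_module"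
  note carr = left_projective_carrier[OF i, where 'k = 'k]
  have ops: "a \<oplus>\<^bsub>?V\<^esub> b = a + b" "c \<odot>\<^bsub>?V\<^esub> a = scale c a" "lact ?V a b = a \<otimes>\<^bsub>path_algebra Q\<^esub> b"
    for a b c by (simp_all add: left_projective_def path_algebra_def)
  show ?thesis
  proof
    show "finite {u. (u, i) \<in> reach Q}"
      by (rule finite_subset[of _ "verts Q"]) (use reach_subset_verts in auto)
    show "bij_betw (\<lambda>a u. path_matrix a u i) (carrier ?V) {f. \<forall>u. u \<notin> {u. (u, i) \<in> reach Q} \<longrightarrow> f u = 0}"
      (is "bij_betw ?\<gamma> _ ?R")
    proof (rule bij_betw_imageI)
      show "inj_on ?\<gamma> (carrier ?V)"
      proof (rule inj_onI)
        fix a b assume ab: "a \<in> carrier ?V" "b \<in> carrier ?V" "?\<gamma> a = ?\<gamma> b"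
        then have "path_matrix a u w = path_matrix b u w" for u w
          by (cases "w = i") (auto simp: carr dest: fun_cong)
        with ab show "a = b" by (intro path_matrix_eqI) (auto simp: carr)
      qed
      have "?\<gamma> a \<in> ?R" if "a \<in> carrier ?V" for a
        using that path_matrix_on_reach[of a] by (auto simp: carr matrices_on_def)
      moreover have "f \<in> ?\<gamma> ` carrier ?V" if f: "f \<in> ?R" for f
      proof -
        have "(\<lambda>u w. if w = i then f u else 0) \<in> matrices_on (reach Q)"
          using f by (auto simp: matrices_on_def)
        then obtain a where a: "a \<in> carrier (path_algebra Q)" "path_matrix a = (\<lambda>u w. if w = i then f u else 0)"
          using ex_path_matrix by blast
        then have "a \<in> carrier ?V" "f = ?\<gamma> a" by (simp_all add: carr)
        then show ?thesis by blast
      qed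
      ultimately show "?\<gamma> ` carrier ?V = ?R" by blast
    qed
  qed (use i in \<open>auto simp: carr ops path_algebra_add_closed path_matrix_add path_algebra_scale_closed
      path_matrix_scale path_algebra_mult_closed path_matrix_mult mat_mult_def\<close>)
qed

lemma right_projective_coordinates:
  assumes j: "j \<in> verts Q"
  shows "right_coordinates Q (right_projective Q j :: ('k::field, ('k, 'v, 'e) palg, ('k, 'v, 'e) palg) right_module)
    (\<lambda>a. path_matrix a j) {w. (j, w) \<in> reach Q}"
proof -
  let ?W = "right_projective Q j :: ('k, ('k, 'v, 'e) palg, ('k, 'v, 'e) palg) right_module"
  note carr = right_projective_carrier[OF j, where 'k = 'k]
  have ops: "a \<oplus>\<^bsub>?W\<^esub> b = a + b" "c \<odot>\<^bsub>?W\<^esub> a = scale c a" "ract ?W a b = a \<otimes>\<^bsub>path_algebra Q\<^esub> b"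
    for a b c by (simp_all add: right_projective_def path_algebra_def)
  show ?thesis
  proof
    show "finite {w. (j, w) \<in> reach Q}"
      by (rule finite_subset[of _ "verts Q"]) (use reach_subset_verts in auto)
    show "bij_betw (\<lambda>a. path_matrix a j) (carrier ?W) {f. \<forall>w. w \<notin> {w. (j, w) \<in> reach Q} \<longrightarrow> f w = 0}"
      (is "bij_betw ?\<gamma> _ ?R")
    proof (rule bij_betw_imageI)
      show "inj_on ?\<gamma> (carrier ?W)"
      proof (rule inj_onI)
        fix a b assume ab: "a \<in> carrier ?W" "b \<in> carrier ?W" "?\<gamma> a = ?\<gamma> b"
        then have "path_matrix a u w = path_matrix b u w" for u w
          by (cases "u = j") (auto simp: carr)
        with ab show "a = b" by (intro path_matrix_eqI) (auto simp: carr)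
      qed
      have "?\<gamma> a \<in> ?R" if "a \<in> carrier ?W" for a
        using that path_matrix_on_reach[of a] by (auto simp: carr matrices_on_def)
      moreover have "f \<in> ?\<gamma> ` carrier ?W" if f: "f \<in> ?R" for f
      proof -
        have "(\<lambda>u w. if u = j then f w else 0) \<in> matrices_on (reach Q)"
          using f by (auto simp: matrices_on_def)
        then obtain a where a: "a \<in> carrier (path_algebra Q)" "path_matrix a = (\<lambda>u w. if u = j then f w else 0)"
          using ex_path_matrix by blast
        then have "a \<in> carrier ?W" "f = ?\<gamma> a" by (simp_all add: carr)
        then show ?thesis by blast
      qed
      ultimately show "?\<gamma> ` carrier ?W = ?R" by blast
    qed
  qed (use j in \<open>auto simp: carr ops path_algebra_add_closed path_matrix_add path_algebra_scale_closed
      path_matrix_scale path_algebra_mult_closed path_matrix_mult mat_mult_def\<close>)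
qed

text \<open>
  For \<open>j = i\<close> these are the pairs of target and source of the paths that pass through \<open>i\<close>.
\<close>

definition reach_through :: "'v \<Rightarrow> 'v \<Rightarrow> ('v \<times> 'v) set" where
  "reach_through i j = {u. (u, i) \<in> reach Q} \<times> {w. (j, w) \<in> reach Q}"

lemma reach_through_subset_verts: "reach_through i j \<subseteq> verts Q \<times> verts Q"
  using reach_subset_verts by (auto simp: reach_through_def)

lemma projective_matrix_model:
  assumes "i \<in> verts Q" "j \<in> verts Q"
  shows "matrix_model Q (projective_bimodule Q i j)
    (tensor_coord (\<lambda>a u. path_matrix a u i) (\<lambda>a. path_matrix a j)) (reach_through i j)"
  unfolding projective_bimodule_def reach_through_def
  by (rule tensor_matrix_model[OF left_projective_coordinates[OF assms(1)]
        right_projective_coordinates[OF assms(2)]])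

lemma regular_matrix_model:
  "matrix_model Q (regular_bimodule Q :: ('k::field, ('k, 'v, 'e) palg, ('k, 'v, 'e) palg) bimodule)
     path_matrix (reach Q)"
proof -
  let ?R = "regular_bimodule Q :: ('k::field, ('k, 'v, 'e) palg, ('k, 'v, 'e) palg) bimodule"
  have zero_in: "(0 :: ('k, 'v, 'e) palg) \<in> carrier (path_algebra Q)" by (simp add: path_algebra_def)
  have "carrier ?R = carrier (path_algebra Q)" "\<zero>\<^bsub>?R\<^esub> = 0" "a \<oplus>\<^bsub>?R\<^esub> b = a + b"
    "c \<odot>\<^bsub>?R\<^esub> a = scale c a" "blact ?R a b = a \<otimes>\<^bsub>path_algebra Q\<^esub> b"
    "bract ?R a b = a \<otimes>\<^bsub>path_algebra Q\<^esub> b" for a b c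
    by (simp_all add: regular_bimodule_def path_algebra_def)
  note ops = this
  show ?thesis
    by unfold_locales
      (simp_all add: ops zero_in path_matrix_bij path_matrix_zero path_algebra_add_closed path_matrix_add
        path_algebra_scale_closed path_matrix_scale path_algebra_mult_closed path_matrix_mult)
qed

end

section \<open>Homomorphisms between matrix models\<close>

context matrix_model
begin

lemma coord_eqI: "\<lbrakk>x \<in> carrier M; y \<in> carrier M; \<And>u w. \<kappa> x u w = \<kappa> y u w\<rbrakk> \<Longrightarrow> x = y"
  by (rule inj_onD[OF bij_betw_imp_inj_on[OF bij]]) auto

lemma coord_in: "x \<in> carrier M \<Longrightarrow> \<kappa> x \<in> matrices_on P"
  using bij_betwE[OF bij] by blast

lemma coord_outside: "x \<in> carrier M \<Longrightarrow> (u, w) \<notin> P \<Longrightarrow> \<kappa> x u w = 0"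
  using coord_in by (auto simp: matrices_on_def)

lemma ex_coord:
  assumes "F \<in> matrices_on P"
  shows "\<exists>x\<in>carrier M. \<kappa> x = F"
  using assms unfolding bij_betw_imp_surj_on[OF bij, symmetric] by blast

lemma abelian_group: "abelian_group M"
proof (rule abelian_groupI)
  fix x assume x: "x \<in> carrier M"
  show "\<exists>y\<in>carrier M. y \<oplus>\<^bsub>M\<^esub> x = \<zero>\<^bsub>M\<^esub>"
    by (rule bexI[of _ "(- 1) \<odot>\<^bsub>M\<^esub> x"], rule coord_eqI)
       (simp_all add: x smult_closed add_closed zero_closed coord_add coord_smult coord_zero)
qed (auto intro!: coord_eqI simp: add_closed zero_closed coord_add coord_zero)

lemma finsum_coord:
  assumes "finite S" "\<And>i. i \<in> S \<Longrightarrow> x i \<in> carrier M"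
  shows "finsum M x S \<in> carrier M \<and> \<kappa> (finsum M x S) u w = (\<Sum>i\<in>S. \<kappa> (x i) u w)"
proof -
  interpret abelian_group M by (rule abelian_group)
  show ?thesis using assms
  proof (induction S rule: finite_induct)
    case empty
    then show ?case by (simp add: zero_closed coord_zero)
  next
    case (insert i S)
    then have "x \<in> S \<rightarrow> carrier M" "x i \<in> carrier M" by auto
    with insert show ?case by (simp add: finsum_insert add_closed coord_add)
  qed
qed

end

locale matrix_model_map =
  X: matrix_model Q X \<kappa> P + Y: matrix_model Q Y \<kappa>' P'
  for Q :: "('v, 'e) pre_digraph"
    and X :: "('k::field, ('k, 'v, 'e) palg, 'm) bimodule" and \<kappa> P
    and Y :: "('k, ('k, 'v, 'e) palg, 'n) bimodule" and \<kappa>' P'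
begin

text \<open>
  In coordinates this homomorphism is the inclusion of matrix spaces.
\<close>

lemma ex_coord_preserving_hom:
  assumes sub: "P \<subseteq> P'"
  shows "\<exists>f\<in>bimodule_hom (path_algebra Q) X Y. \<forall>x\<in>carrier X. \<kappa>' (f x) = \<kappa> x"
proof -
  have "\<forall>x\<in>carrier X. \<exists>y\<in>carrier Y. \<kappa>' y = \<kappa> x"
    using X.coord_in matrices_on_mono[OF sub] Y.ex_coord by blast
  then obtain f where f: "\<And>x. x \<in> carrier X \<Longrightarrow> f x \<in> carrier Y"
    "\<And>x. x \<in> carrier X \<Longrightarrow> \<kappa>' (f x) = \<kappa> x"
    by metis
  have "f \<in> bimodule_hom (path_algebra Q) X Y"
    unfolding bimodule_hom_def
    by (auto intro!: Y.coord_eqI simp: f X.add_closed Y.add_closed X.coord_add Y.coord_add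
        X.blact_closed Y.blact_closed X.coord_blact Y.coord_blact
        X.bract_closed Y.bract_closed X.coord_bract Y.coord_bract)
  with f show ?thesis by blast
qed

lemma same_support_isomorphic:
  assumes "P = P'"
  shows "bimodule_isomorphic (path_algebra Q) X Y"
proof -
  obtain f where f: "f \<in> bimodule_hom (path_algebra Q) X Y" "\<And>x. x \<in> carrier X \<Longrightarrow> \<kappa>' (f x) = \<kappa> x"
    using ex_coord_preserving_hom assms by blast
  have into: "f x \<in> carrier Y" if "x \<in> carrier X" for x
    using f(1) that by (auto simp: bimodule_hom_def)
  have "bij_betw f (carrier X) (carrier Y)"
  proof (rule bij_betw_imageI)
    show "inj_on f (carrier X)"
      by (rule inj_onI, rule X.coord_eqI) (auto simp: f(2)[symmetric])
    have "y \<in> f ` carrier X" if y: "y \<in> carrier Y" for y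
    proof -
      obtain x where x: "x \<in> carrier X" "\<kappa> x = \<kappa>' y"
        using X.ex_coord Y.coord_in[OF y] assms by blast
      then have "f x = y" by (intro Y.coord_eqI) (simp_all add: into y f(2))
      with x show ?thesis by blast
    qed
    with into show "f ` carrier X = carrier Y" by blast
  qed
  with f(1) show ?thesis unfolding bimodule_isomorphic_def by blast
qed

end

text \<open>
  A product with a path matrix can only move nonzero entries along \<open>reach\<close>, so a support
  that absorbs \<open>reach\<close> on both sides cuts out a model of its own.
\<close>

lemma (in matrix_model) submodel:
  assumes Q: "fin_digraph Q" and sub: "P' \<subseteq> P"
    and left: "\<And>u v w. \<lbrakk>(u, v) \<in> reach Q; (v, w) \<in> P'\<rbrakk> \<Longrightarrow> (u, w) \<in> P'"
    and right: "\<And>u v w. \<lbrakk>(u, v) \<in> P'; (v, w) \<in> reach Q\<rbrakk> \<Longrightarrow> (u, w) \<in> P'"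
  shows "matrix_model Q (M\<lparr>carrier := {x \<in> carrier M. \<kappa> x \<in> matrices_on P'}\<rparr>) \<kappa> P'"
proof -
  interpret fin_digraph Q by fact
  have l: "mat_mult Q (path_matrix a) F \<in> matrices_on P'"
    if "a \<in> carrier (path_algebra Q)" "F \<in> matrices_on P'" for a :: "('k, 'v, 'e) palg" and F
    using left that path_matrix_on_reach[OF that(1)]
    by (fastforce simp: matrices_on_def mat_mult_def intro!: sum.neutral)
  have r: "mat_mult Q F (path_matrix a) \<in> matrices_on P'"
    if "a \<in> carrier (path_algebra Q)" "F \<in> matrices_on P'" for a :: "('k, 'v, 'e) palg" and F
    using right that path_matrix_on_reach[OF that(1)]
    by (fastforce simp: matrices_on_def mat_mult_def intro!: sum.neutral)
  have b: "bij_betw \<kappa> {x \<in> carrier M. \<kappa> x \<in> matrices_on P'} (matrices_on P')"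
  proof (rule bij_betw_imageI)
    show "inj_on \<kappa> {x \<in> carrier M. \<kappa> x \<in> matrices_on P'}"
      by (rule inj_on_subset[OF bij_betw_imp_inj_on[OF bij]]) auto
    show "\<kappa> ` {x \<in> carrier M. \<kappa> x \<in> matrices_on P'} = matrices_on P'"
      using matrices_on_mono[OF sub] ex_coord by blast
  qed
  show ?thesis
  proof
    show "bij_betw \<kappa> (carrier (M\<lparr>carrier := {x \<in> carrier M. \<kappa> x \<in> matrices_on P'}\<rparr>)) (matrices_on P')"
      using b by simp
  qed (simp_all add: zero_closed coord_zero add_closed coord_add smult_closed coord_smult blact_closed
      coord_blact bract_closed coord_bract l r, simp_all add: matrices_on_def coord_zero coord_add coord_smult)
qed

lemma (in matrix_model) submodel_subbimodule:
  assumes sub: "matrix_model Q (M\<lparr>carrier := S\<rparr>) \<kappa> P'" and S: "S \<subseteq> carrier M"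
  shows "subbimodule (path_algebra Q) S M"
proof -
  interpret S: matrix_model Q "M\<lparr>carrier := S\<rparr>" \<kappa> P' by (rule sub)
  interpret abelian_group M by (rule abelian_group)
  have "\<ominus>\<^bsub>M\<^esub> x = (- 1) \<odot>\<^bsub>M\<^esub> x" if x: "x \<in> carrier M" for x
    by (rule minus_equality, rule coord_eqI)
       (simp_all add: x smult_closed add_closed zero_closed coord_add coord_smult coord_zero)
  then have minus: "\<ominus>\<^bsub>M\<^esub> x \<in> S" if "x \<in> S" for x
    using S.smult_closed[of x "- 1"] that S by auto
  have "subgroup S (add_monoid M)"
    using S S.zero_closed S.add_closed minus
    by (auto simp: subgroup_def a_inv_def)
  then show ?thesis
    using S.blact_closed S.bract_closed by (auto simp: subbimodule_def additive_subgroup_def)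
qed

context unique_path_quiver
begin

lemma ex_reach_path:
  "(u, w) \<in> reach Q \<Longrightarrow> \<exists>p\<in>qpaths Q. ptarget p = u \<and> psource p = w"
  by (auto simp: reach_def)

text \<open>
  Write \<open>E\<close> for matrix units.  Every entry is isolated by the idempotents at its row and its
  column, so only multiples of \<open>E u w\<close> have to be considered.  If \<open>(u, w)\<close> lies in the
  support of \<open>X\<close>, there are paths \<open>p\<close> from \<open>i\<close> to \<open>u\<close> and \<open>q\<close> from \<open>w\<close> to \<open>j\<close>, and
  \<open>E u w = p (E i j) q\<close>, so the image of \<open>E i j\<close> determines the homomorphism.  Only its
  entry \<open>c\<close> at \<open>(i, j)\<close> enters the result.  The scalar in front of \<open>E u w\<close> is carried by an
  element of the algebra, the multiple of \<open>p\<close>, so compatibility with the two actions covers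
  it.
\<close>

lemma hom_is_scalar:
  fixes X :: "('k::field, ('k, 'v, 'e) palg, 'm) bimodule"
    and Y :: "('k, ('k, 'v, 'e) palg, 'n) bimodule"
  assumes X: "matrix_model Q X \<kappa> (reach_through i j)"
    and Y: "matrix_model Q Y \<kappa>' (verts Q \<times> verts Q)"
    and i: "i \<in> verts Q" and j: "j \<in> verts Q"
    and \<phi>: "\<phi> \<in> bimodule_hom (path_algebra Q) X Y"
  shows "\<exists>c. \<forall>x\<in>carrier X. \<forall>u w. \<kappa>' (\<phi> x) u w = c * \<kappa> x u w"
proof -
  interpret X: matrix_model Q X \<kappa> "reach_through i j" by (rule X)
  interpret Y: matrix_model Q Y \<kappa>' "verts Q \<times> verts Q" by (rule Y)
  let ?A = "carrier (path_algebra Q) :: ('k, 'v, 'e) palg set"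
  have \<phi>_in: "\<phi> x \<in> carrier Y" if "x \<in> carrier X" for x
    using \<phi> that by (auto simp: bimodule_hom_def)
  have hom: "\<phi> (blact X a (bract X x b)) = blact Y a (bract Y (\<phi> x) b)"
    if "a \<in> ?A" "b \<in> ?A" "x \<in> carrier X" for a b x
    using \<phi> that X.bract_closed by (auto simp: bimodule_hom_def)
  have X_coord: "blact X a (bract X x b) \<in> carrier X"
    "\<kappa> (blact X a (bract X x b)) = mat_mult Q (path_matrix a) (mat_mult Q (\<kappa> x) (path_matrix b))"
    if "a \<in> ?A" "b \<in> ?A" "x \<in> carrier X" for a b x
    using that by (simp_all add: X.blact_closed X.bract_closed X.coord_blact X.coord_bract)
  have Y_coord: "\<kappa>' (\<phi> (blact X a (bract X x b)))
      = mat_mult Q (path_matrix a) (mat_mult Q (\<kappa>' (\<phi> x)) (path_matrix b))"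
    if "a \<in> ?A" "b \<in> ?A" "x \<in> carrier X" for a b x
    using that by (simp add: hom \<phi>_in Y.bract_closed Y.coord_blact Y.coord_bract)
  have "elem_matrix i j 1 \<in> matrices_on (reach_through i j)"
    using reach_refl i j by (auto simp: matrices_on_def elem_matrix_def reach_through_def)
  then obtain g where g: "g \<in> carrier X" "\<kappa> g = elem_matrix i j 1"
    using X.ex_coord by blast
  define c where "c = \<kappa>' (\<phi> g) i j"
  have "\<kappa>' (\<phi> x) u w = c * \<kappa> x u w" if x: "x \<in> carrier X" for x u w
  proof (cases "u \<in> verts Q \<and> w \<in> verts Q")
    case False
    then have "(u, w) \<notin> reach_through i j"
      using reach_subset_verts by (auto simp: reach_through_def)
    with False show ?thesis
      using X.coord_outside[OF x] Y.coord_outside[OF \<phi>_in[OF x]] by auto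
  next
    case True
    have triv: "(trivial_path v :: ('k, 'v, 'e) palg) \<in> ?A" if "v \<in> verts Q" for v
      using that by (rule trivial_path_closed)
    \<comment> \<open>The two idempotents keep the entry at \<open>(u, w)\<close> and erase all others, in \<open>X\<close> and in \<open>Y\<close>.\<close>
    let ?y = "blact X (trivial_path u) (bract X x (trivial_path w))"
    have entry: "\<kappa>' (\<phi> ?y) u w = \<kappa>' (\<phi> x) u w"
      using True by (simp add: Y_coord triv x path_matrix_trivial_path elem_matrix_mult)
    have y: "?y \<in> carrier X" "\<kappa> ?y = elem_matrix u w (\<kappa> x u w)"
      using True by (simp_all add: X_coord triv x path_matrix_trivial_path elem_matrix_mult fun_eq_iff)
        (auto simp: elem_matrix_def)
    show ?thesis
    proof (cases "(u, w) \<in> reach_through i j")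
      case True
      then obtain p q where p: "p \<in> qpaths Q" "ptarget p = u" "psource p = i"
        and q: "q \<in> qpaths Q" "ptarget q = j" "psource q = w"
        unfolding reach_through_def using ex_reach_path by blast
      let ?a = "Poly_Mapping.single p (\<kappa> x u w)" and ?b = "Poly_Mapping.single q (1 :: 'k)"
      have ab: "?a \<in> ?A" "?b \<in> ?A" using p q by (auto simp: path_algebra_single_closed)
      have mats: "path_matrix ?a = elem_matrix u i (\<kappa> x u w)" "path_matrix ?b = elem_matrix j w 1"
        using p q by (simp_all add: path_matrix_single)
      have uw: "u \<in> verts Q" "w \<in> verts Q" using \<open>u \<in> verts Q \<and> w \<in> verts Q\<close> by auto
      have "?y = blact X ?a (bract X g ?b)"
        by (rule X.coord_eqI)
           (auto simp: y X_coord[OF ab g(1)] mats elem_matrix_mult i j uw g(2), auto simp: elem_matrix_def)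
      then have "\<kappa>' (\<phi> ?y) u w = \<kappa> x u w * c"
        by (simp add: Y_coord[OF ab g(1)] mats elem_matrix_mult i j uw c_def)
      with entry show ?thesis by (simp add: mult.commute)
    next
      case False
      have zero_in: "(0 :: ('k, 'v, 'e) palg) \<in> ?A" by (simp add: path_algebra_def)
      have zero: "\<kappa> x u w = 0" using X.coord_outside[OF x False] .
      \<comment> \<open>The zero element is written as a product with \<open>0 \<in> A\<close>, so that compatibility with the
        action shows that \<open>\<phi>\<close> maps it to zero.\<close>
      have "?y = blact X 0 (bract X g (trivial_path w))"
        using True by (intro X.coord_eqI)
          (auto simp: y X_coord zero_in triv g(1) zero elem_matrix_def mat_mult_def path_matrix_zero)
      then have "\<kappa>' (\<phi> ?y) u w = 0"
        using True by (simp add: Y_coord zero_in triv g(1) mat_mult_def path_matrix_zero)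
      with entry zero show ?thesis by simp
    qed
  qed
  then show ?thesis by blast
qed

lemma nonzero_hom_is_nonzero_scalar:
  fixes X :: "('k::field, ('k, 'v, 'e) palg, 'm) bimodule"
    and Y :: "('k, ('k, 'v, 'e) palg, 'n) bimodule"
  assumes X: "matrix_model Q X \<kappa> (reach_through i j)"
    and Y: "matrix_model Q Y \<kappa>' (verts Q \<times> verts Q)"
    and i: "i \<in> verts Q" and j: "j \<in> verts Q"
    and \<phi>: "\<phi> \<in> nonzero_bimodule_hom (path_algebra Q) X Y"
  shows "\<exists>c. c \<noteq> 0 \<and> (\<forall>x\<in>carrier X. \<phi> x \<in> carrier Y \<and> (\<forall>u w. \<kappa>' (\<phi> x) u w = c * \<kappa> x u w))"
proof -
  interpret Y: matrix_model Q Y \<kappa>' "verts Q \<times> verts Q" by (rule Y)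
  from \<phi> obtain x where hom: "\<phi> \<in> bimodule_hom (path_algebra Q) X Y"
    and x: "x \<in> carrier X" "\<phi> x \<noteq> \<zero>\<^bsub>Y\<^esub>"
    by (auto simp: nonzero_bimodule_hom_def)
  from hom have into: "\<phi> x \<in> carrier Y" if "x \<in> carrier X" for x
    using that by (auto simp: bimodule_hom_def)
  from hom_is_scalar[OF X Y i j hom] obtain c
    where c: "\<forall>x\<in>carrier X. \<forall>u w. \<kappa>' (\<phi> x) u w = c * \<kappa> x u w" by blast
  have "c \<noteq> 0"
  proof
    assume "c = 0"
    then have "\<phi> x = \<zero>\<^bsub>Y\<^esub>"
      using c x by (intro Y.coord_eqI) (auto simp: into Y.zero_closed Y.coord_zero)
    with x show False by simp
  qed
  with c into show ?thesis by blast
qed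

lemma nonzero_bimodule_hom_unique_inj:
  fixes X :: "('k::field, ('k, 'v, 'e) palg, 'm) bimodule"
    and Y :: "('k, ('k, 'v, 'e) palg, 'n) bimodule"
  assumes X: "matrix_model Q X \<kappa> (reach_through i j)"
    and Y: "matrix_model Q Y \<kappa>' (verts Q \<times> verts Q)"
    and i: "i \<in> verts Q" and j: "j \<in> verts Q"
  shows "nonzero_bimodule_hom (path_algebra Q) X Y \<noteq> {}"
    and "\<lbrakk>\<phi> \<in> nonzero_bimodule_hom (path_algebra Q) X Y; \<psi> \<in> nonzero_bimodule_hom (path_algebra Q) X Y\<rbrakk>
      \<Longrightarrow> \<exists>c. c \<noteq> 0 \<and> (\<forall>x\<in>carrier X. \<psi> x = c \<odot>\<^bsub>Y\<^esub> \<phi> x)"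
    and "\<phi> \<in> nonzero_bimodule_hom (path_algebra Q) X Y \<Longrightarrow> inj_on \<phi> (carrier X)"
proof -
  interpret X: matrix_model Q X \<kappa> "reach_through i j" by (rule X)
  interpret Y: matrix_model Q Y \<kappa>' "verts Q \<times> verts Q" by (rule Y)
  interpret matrix_model_map Q X \<kappa> "reach_through i j" Y \<kappa>' "verts Q \<times> verts Q" ..
  note scalar = nonzero_hom_is_nonzero_scalar[OF X Y i j]
  have "elem_matrix i j 1 \<in> matrices_on (reach_through i j)"
    using reach_refl i j by (auto simp: matrices_on_def elem_matrix_def reach_through_def)
  then obtain g where g: "g \<in> carrier X" "\<kappa> g = elem_matrix i j 1"
    using X.ex_coord by blast
  obtain f where f: "f \<in> bimodule_hom (path_algebra Q) X Y" "\<And>x. x \<in> carrier X \<Longrightarrow> \<kappa>' (f x) = \<kappa> x"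
    using ex_coord_preserving_hom[OF reach_through_subset_verts] by blast
  have "\<kappa>' (f g) i j = 1" using f(2) g by (simp add: elem_matrix_def)
  then have "f g \<noteq> \<zero>\<^bsub>Y\<^esub>" using Y.coord_zero[of i j] by auto
  with f(1) g(1) show "nonzero_bimodule_hom (path_algebra Q) X Y \<noteq> {}"
    by (auto simp: nonzero_bimodule_hom_def)
  show "\<exists>c. c \<noteq> 0 \<and> (\<forall>x\<in>carrier X. \<psi> x = c \<odot>\<^bsub>Y\<^esub> \<phi> x)"
    if \<phi>: "\<phi> \<in> nonzero_bimodule_hom (path_algebra Q) X Y" and \<psi>: "\<psi> \<in> nonzero_bimodule_hom (path_algebra Q) X Y"
  proof -
    from scalar[OF \<phi>] obtain c where c: "c \<noteq> 0" "\<And>x. x \<in> carrier X \<Longrightarrow> \<phi> x \<in> carrier Y"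
      "\<And>x u w. x \<in> carrier X \<Longrightarrow> \<kappa>' (\<phi> x) u w = c * \<kappa> x u w" by blast
    from scalar[OF \<psi>] obtain d where d: "d \<noteq> 0" "\<And>x. x \<in> carrier X \<Longrightarrow> \<psi> x \<in> carrier Y"
      "\<And>x u w. x \<in> carrier X \<Longrightarrow> \<kappa>' (\<psi> x) u w = d * \<kappa> x u w" by blast
    have "\<psi> x = (d / c) \<odot>\<^bsub>Y\<^esub> \<phi> x" if "x \<in> carrier X" for x
      using that c d by (intro Y.coord_eqI) (simp_all add: Y.smult_closed Y.coord_smult)
    moreover have "d / c \<noteq> 0" using c d by simp
    ultimately show ?thesis by blast
  qed
  show "inj_on \<phi> (carrier X)" if \<phi>: "\<phi> \<in> nonzero_bimodule_hom (path_algebra Q) X Y"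
  proof (rule inj_onI)
    from scalar[OF \<phi>] obtain c where c: "c \<noteq> 0"
      "\<And>x u w. x \<in> carrier X \<Longrightarrow> \<kappa>' (\<phi> x) u w = c * \<kappa> x u w" by blast
    fix x y assume xy: "x \<in> carrier X" "y \<in> carrier X" "\<phi> x = \<phi> y"
    have "c * \<kappa> x u w = c * \<kappa> y u w" for u w
      by (simp add: c(2)[symmetric] xy)
    with c(1) xy show "x = y" by (intro X.coord_eqI) auto
  qed
qed

lemma image_nonzero_bimodule_hom:
  fixes X :: "('k::field, ('k, 'v, 'e) palg, 'm) bimodule"
    and Y :: "('k, ('k, 'v, 'e) palg, 'n) bimodule"
  assumes X: "matrix_model Q X \<kappa> (reach_through i j)"
    and Y: "matrix_model Q Y \<kappa>' (verts Q \<times> verts Q)"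
    and i: "i \<in> verts Q" and j: "j \<in> verts Q"
    and \<phi>: "\<phi> \<in> nonzero_bimodule_hom (path_algebra Q) X Y"
  shows "\<phi> ` carrier X = {y \<in> carrier Y. \<kappa>' y \<in> matrices_on (reach_through i j)}"
proof -
  interpret X: matrix_model Q X \<kappa> "reach_through i j" by (rule X)
  interpret Y: matrix_model Q Y \<kappa>' "verts Q \<times> verts Q" by (rule Y)
  from nonzero_hom_is_nonzero_scalar[OF X Y i j \<phi>] obtain c
    where c: "c \<noteq> 0" "\<And>x. x \<in> carrier X \<Longrightarrow> \<phi> x \<in> carrier Y"
      "\<And>x u w. x \<in> carrier X \<Longrightarrow> \<kappa>' (\<phi> x) u w = c * \<kappa> x u w" by blast
  show ?thesis
  proof (intro equalityI subsetI)
    fix y assume "y \<in> \<phi> ` carrier X"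
    then show "y \<in> {y \<in> carrier Y. \<kappa>' y \<in> matrices_on (reach_through i j)}"
      using c X.coord_outside by (auto simp: matrices_on_def)
  next
    fix y assume y: "y \<in> {y \<in> carrier Y. \<kappa>' y \<in> matrices_on (reach_through i j)}"
    then have "(\<lambda>u w. \<kappa>' y u w / c) \<in> matrices_on (reach_through i j)"
      by (auto simp: matrices_on_def)
    then obtain x where x: "x \<in> carrier X" "\<kappa> x = (\<lambda>u w. \<kappa>' y u w / c)"
      using X.ex_coord by blast
    then have "\<phi> x = y" using y c by (intro Y.coord_eqI) simp_all
    with x show "y \<in> \<phi> ` carrier X" by blast
  qed
qed

text \<open>
  Composing paths shows that the support at every \<open>i\<close> is contained in \<open>reach\<close>.  Conversely a
  matrix supported on \<open>reach\<close> is the sum of its rows, and row \<open>i\<close> is supported at \<open>i\<close>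
  because of the trivial path at \<open>i\<close>.
\<close>

lemma sum_of_images:
  fixes Y :: "('k::field, ('k, 'v, 'e) palg, 'n) bimodule"
  assumes Y: "matrix_model Q Y \<kappa> (verts Q \<times> verts Q)"
  shows "sum_of_subsets Y (verts Q) (\<lambda>i. {y \<in> carrier Y. \<kappa> y \<in> matrices_on (reach_through i i)})
    = {y \<in> carrier Y. \<kappa> y \<in> matrices_on (reach Q)}"
proof (intro equalityI subsetI)
  interpret Y: matrix_model Q Y \<kappa> "verts Q \<times> verts Q" by (rule Y)
  fix y assume "y \<in> sum_of_subsets Y (verts Q) (\<lambda>i. {y \<in> carrier Y. \<kappa> y \<in> matrices_on (reach_through i i)})"
  then obtain x where y: "y = finsum Y x (verts Q)"
    and x: "\<And>i. i \<in> verts Q \<Longrightarrow> x i \<in> carrier Y" "\<And>i. i \<in> verts Q \<Longrightarrow> \<kappa> (x i) \<in> matrices_on (reach_through i i)"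
    unfolding sum_of_subsets_def by blast
  have fin: "y \<in> carrier Y" "\<kappa> y u w = (\<Sum>i\<in>verts Q. \<kappa> (x i) u w)" for u w
    using Y.finsum_coord[of "verts Q" x u w] x(1) y by auto
  have "reach_through i i \<subseteq> reach Q" for i
    using reach_trans by (auto simp: reach_through_def)
  then have "\<kappa> (x i) u w = 0" if "i \<in> verts Q" "(u, w) \<notin> reach Q" for i u w
    using x(2)[OF that(1)] that(2) by (auto simp: matrices_on_def)
  with fin show "y \<in> {y \<in> carrier Y. \<kappa> y \<in> matrices_on (reach Q)}"
    by (simp add: matrices_on_def)
next
  interpret Y: matrix_model Q Y \<kappa> "verts Q \<times> verts Q" by (rule Y)
  fix y assume y: "y \<in> {y \<in> carrier Y. \<kappa> y \<in> matrices_on (reach Q)}"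
  have row: "\<exists>x\<in>carrier Y. \<kappa> x = (\<lambda>u w. if u = i then \<kappa> y u w else 0)" for i
    using y by (intro Y.ex_coord) (auto simp: matrices_on_def dest: Y.coord_outside)
  then obtain x where x: "\<And>i. x i \<in> carrier Y" "\<And>i. \<kappa> (x i) = (\<lambda>u w. if u = i then \<kappa> y u w else 0)"
    by metis
  have "\<kappa> (x i) \<in> matrices_on (reach_through i i)" if "i \<in> verts Q" for i
    using y reach_refl[OF that] by (auto simp: x matrices_on_def reach_through_def)
  moreover have "finsum Y x (verts Q) = y"
  proof (rule Y.coord_eqI)
    show "finsum Y x (verts Q) \<in> carrier Y" "y \<in> carrier Y"
      using Y.finsum_coord[of "verts Q" x] x y by auto
    show "\<kappa> (finsum Y x (verts Q)) u w = \<kappa> y u w" for u w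
    proof -
      have "\<kappa> (finsum Y x (verts Q)) u w = (\<Sum>i\<in>verts Q. if u = i then \<kappa> y u w else 0)"
        using Y.finsum_coord[of "verts Q" x u w] x by simp
      also have "\<dots> = \<kappa> y u w"
        using y by (auto simp: sum.delta' dest: Y.coord_outside)
      finally show ?thesis .
    qed
  qed
  ultimately show "y \<in> sum_of_subsets Y (verts Q) (\<lambda>i. {y \<in> carrier Y. \<kappa> y \<in> matrices_on (reach_through i i)})"
    unfolding sum_of_subsets_def using x(1) by blast
qed

end

theorem proposition19:
  fixes Q :: "('v, 'e) pre_digraph"
    and A :: "('k::alg_closed_field, 'v, 'e) palg ring"
    and X :: "'v \<Rightarrow> 'v \<Rightarrow> ('k, ('k, 'v, 'e) palg,
                (('k, 'v, 'e) palg \<times> ('k, 'v, 'e) palg \<Rightarrow>\<^sub>0 'k) set) bimodule"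
    and NN :: "('k, ('k, 'v, 'e) palg, (('v \<Rightarrow> 'k) \<times> ('v \<Rightarrow> 'k) \<Rightarrow>\<^sub>0 'k) set) bimodule"
  assumes tree: "tree_quiver Q"
    and A: "A = path_algebra Q"
    and X: "\<And>i j. X i j = projective_bimodule Q i j"
    and NN: "NN = natural_bimodule Q"
  shows
    "(\<forall>i\<in>verts Q. \<forall>j\<in>verts Q.
        nonzero_bimodule_hom A (X i j) NN \<noteq> {} \<and>
        (\<forall>\<phi>\<in>nonzero_bimodule_hom A (X i j) NN.
           (\<forall>\<psi>\<in>nonzero_bimodule_hom A (X i j) NN.
              \<exists>c. c \<noteq> 0 \<and> (\<forall>x\<in>carrier (X i j). \<psi> x = c \<odot>\<^bsub>NN\<^esub> \<phi> x)) \<and>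
           inj_on \<phi> (carrier (X i j)))) \<and>
     (\<forall>\<phi> S. (\<forall>i\<in>verts Q. \<phi> i \<in> nonzero_bimodule_hom A (X i i) NN) \<longrightarrow>
        S = sum_of_subsets NN (verts Q) (\<lambda>i. \<phi> i ` carrier (X i i)) \<longrightarrow>
        subbimodule A S NN \<and>
        bimodule_isomorphic A (NN\<lparr>carrier := S\<rparr>) (regular_bimodule Q))"
proof -
  interpret unique_path_quiver Q by (rule tree_quiver_unique_path_quiver[OF tree])
  let ?\<kappa> = "\<lambda>i j. tensor_coord (\<lambda>a u. path_matrix a u i) (\<lambda>a. path_matrix a j)"
  let ?\<nu> = "tensor_coord (\<lambda>x. x) (\<lambda>x. x) :: (('v \<Rightarrow> 'k) \<times> ('v \<Rightarrow> 'k) \<Rightarrow>\<^sub>0 'k) set \<Rightarrow> _"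
  have modelX: "matrix_model Q (X i j) (?\<kappa> i j) (reach_through i j)" if "i \<in> verts Q" "j \<in> verts Q" for i j
    unfolding X using that by (rule projective_matrix_model)
  have modelN: "matrix_model Q NN ?\<nu> (verts Q \<times> verts Q)"
    unfolding NN by (rule natural_matrix_model)
  interpret N: matrix_model Q NN ?\<nu> "verts Q \<times> verts Q" by (rule modelN)
  show ?thesis
  proof (intro conjI ballI allI impI)
    fix i j assume ij: "i \<in> verts Q" "j \<in> verts Q"
    note hom = nonzero_bimodule_hom_unique_inj[OF modelX[OF ij] modelN ij, folded A]
    show "nonzero_bimodule_hom A (X i j) NN \<noteq> {}" by (rule hom(1))
    fix \<phi> assume \<phi>: "\<phi> \<in> nonzero_bimodule_hom A (X i j) NN"
    show "inj_on \<phi> (carrier (X i j))" by (rule hom(3)[OF \<phi>])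
    fix \<psi> assume "\<psi> \<in> nonzero_bimodule_hom A (X i j) NN"
    then show "\<exists>c. c \<noteq> 0 \<and> (\<forall>x\<in>carrier (X i j). \<psi> x = c \<odot>\<^bsub>NN\<^esub> \<phi> x)" by (rule hom(2)[OF \<phi>])
  next
    fix \<phi> S
    assume \<phi>: "\<forall>i\<in>verts Q. \<phi> i \<in> nonzero_bimodule_hom A (X i i) NN"
      and S_def: "S = sum_of_subsets NN (verts Q) (\<lambda>i. \<phi> i ` carrier (X i i))"
    have "\<phi> i ` carrier (X i i) = {y \<in> carrier NN. ?\<nu> y \<in> matrices_on (reach_through i i)}"
      if "i \<in> verts Q" for i
      using image_nonzero_bimodule_hom[OF modelX[OF that that] modelN that that] \<phi> that A by blast
    then have "S = sum_of_subsets NN (verts Q)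
        (\<lambda>i. {y \<in> carrier NN. ?\<nu> y \<in> matrices_on (reach_through i i)})"
      unfolding S_def sum_of_subsets_def by simp
    also have "\<dots> = {y \<in> carrier NN. ?\<nu> y \<in> matrices_on (reach Q)}"
      by (rule sum_of_images[OF modelN])
    finally have S: "S = {y \<in> carrier NN. ?\<nu> y \<in> matrices_on (reach Q)}" .
    have modelS: "matrix_model Q (NN\<lparr>carrier := S\<rparr>) ?\<nu> (reach Q)"
      unfolding S
      by (rule N.submodel[OF fin_digraph_axioms reach_subset_verts]) (blast intro: reach_trans)+
    show "subbimodule A S NN"
      unfolding A by (rule N.submodel_subbimodule[OF modelS]) (simp add: S)
    interpret S: matrix_model_map Q "NN\<lparr>carrier := S\<rparr>" ?\<nu> "reach Q" "regular_bimodule Q" path_matrix "reach Q"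
      by (intro matrix_model_map.intro modelS regular_matrix_model)
    show "bimodule_isomorphic A (NN\<lparr>carrier := S\<rparr>) (regular_bimodule Q)"
      unfolding A by (rule S.same_support_isomorphic) simp
  qed
qed

end
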